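(* Let $2\le k<n$ be integers and let $V$ be a $C^1$ distribution of $k$-planes on $\mathbb{R}^n$. Then for every real number $d$ with $0\le d<k$ there exists a $k$-dimensional submanifold $S\subset\mathbb{R}^n$ of class $C^{1,1}$ such that $$\dim_{\mathscr{H}}\bigl(\tau(S,V)\bigr)=d,$$ where $\dim_{\mathscr{H}}$ denotes Hausdorff dimension and $\tau(S,V)$ is the tangency set of $S$ with respect to $V$.
   Context: A distribution of $k$-planes on $\mathbb{R}^n$ is a map $V$ assigning to every $x\in\mathbb{R}^n$ a $k$-dimensional linear subspace $V(x)$ of $\mathbb{R}^n$. It is of class $C^1$ if it is locally spanned by $k$ vector fields of class $C^1$, i.e. locally there are $C^1$ vector fields $X_1,\dots,X_k$ with $V(x)=\mathrm{span}\{X_1(x),\dots,X_k(x)\}$. For a $k$-dimensional submanifold $S$ of class $C^1$, the tangency set is $\tau(S,V):=\{x\in S:\ \mathrm{Tan}(S,x)=V(x)\}$, where $\mathrm{Tan}(S,x)$ is the classical tangent space of $S$ at $x$ (a linear subspace of $\mathbb{R}^n$). *)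

theory Defs
  imports "HOL-Analysis.Analysis"
begin

section \<open>Maps of class \<open>C\<^sup>1\<close> and \<open>C\<^sup>1\<^sup>,\<^sup>1\<close>\<close>

definition C1_map_on ::
  "'a::euclidean_space set \<Rightarrow> ('a \<Rightarrow> 'b::euclidean_space) \<Rightarrow> bool" where
  "C1_map_on U f \<longleftrightarrow>
     (\<exists>f' :: 'a \<Rightarrow> 'a \<Rightarrow>\<^sub>L 'b.
        (\<forall>x\<in>U. (f has_derivative blinfun_apply (f' x)) (at x)) \<and> continuous_on U f')"

text \<open>The derivative is required to be \<^emph>\<open>locally\<close> Lipschitz, which is the right notion for
  charts of submanifolds: shrinking the domain of a chart makes it globally Lipschitz.\<close>

definition C11_map_on ::
  "'a::euclidean_space set \<Rightarrow> ('a \<Rightarrow> 'b::euclidean_space) \<Rightarrow> bool" where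
  "C11_map_on U f \<longleftrightarrow>
     (\<exists>f' :: 'a \<Rightarrow> 'a \<Rightarrow>\<^sub>L 'b.
        (\<forall>x\<in>U. (f has_derivative blinfun_apply (f' x)) (at x)) \<and>
        (\<forall>x\<in>U. \<exists>e>0. \<exists>L. L-lipschitz_on (ball x e \<inter> U) f'))"


section \<open>Distributions of planes\<close>

definition plane_distribution :: "nat \<Rightarrow> ('a::euclidean_space \<Rightarrow> 'a set) \<Rightarrow> bool" where
  "plane_distribution k V \<longleftrightarrow> (\<forall>x. subspace (V x) \<and> dim (V x) = k)"

definition C1_distribution :: "nat \<Rightarrow> ('a::euclidean_space \<Rightarrow> 'a set) \<Rightarrow> bool" where
  "C1_distribution k V \<longleftrightarrow> plane_distribution k V \<and>
     (\<forall>p. \<exists>U. open U \<and> p \<in> U \<and>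
        (\<exists>X :: nat \<Rightarrow> 'a \<Rightarrow> 'a. (\<forall>i<k. C1_map_on U (X i)) \<and>
           (\<forall>x\<in>U. V x = span ((\<lambda>i. X i x) ` {..<k}))))"


section \<open>Submanifolds, tangent spaces and tangency sets\<close>

text \<open>Embedded submanifolds: near each of its points, \<open>S\<close> is mapped by a \<open>C\<^sup>1\<^sup>,\<^sup>1\<close> diffeomorphism
  between open sets of the ambient space to an open piece of a \<open>k\<close>-dimensional linear subspace
  \<open>E\<close>. Allowing any \<open>E\<close> amounts to a linear change of coordinates in the usual model
  \<open>\<real>\<^sup>k \<times> {0}\<close>. Neither closedness nor connectedness is imposed; the empty set is excluded.\<close>

definition C11_submanifold :: "nat \<Rightarrow> 'a::euclidean_space set \<Rightarrow> bool" where
  "C11_submanifold k S \<longleftrightarrow> S \<noteq> {} \<and>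
     (\<forall>p\<in>S. \<exists>U W \<phi> \<psi> E.
        open U \<and> p \<in> U \<and> open W \<and> homeomorphism U W \<phi> \<psi> \<and>
        C11_map_on U \<phi> \<and> C11_map_on W \<psi> \<and>
        subspace (E :: 'a set) \<and> dim E = k \<and> \<phi> ` (S \<inter> U) = E \<inter> W)"

text \<open>The velocities at \<open>x\<close> of the \<open>C\<^sup>1\<close> curves that run in \<open>S\<close>.\<close>

definition tangent_space :: "'a::euclidean_space set \<Rightarrow> 'a \<Rightarrow> 'a set" where
  "tangent_space S x =
     {v. \<exists>e>0. \<exists>\<gamma> :: real \<Rightarrow> 'a. \<gamma> C1_differentiable_on {-e<..<e} \<and> \<gamma> ` {-e<..<e} \<subseteq> S \<and>
           \<gamma> 0 = x \<and> (\<gamma> has_vector_derivative v) (at 0)}"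

definition tangency_set :: "'a::euclidean_space set \<Rightarrow> ('a \<Rightarrow> 'a set) \<Rightarrow> 'a set" where
  "tangency_set S V = {x \<in> S. tangent_space S x = V x}"


section \<open>Hausdorff measure and Hausdorff dimension\<close>

text \<open>The contribution \<open>(diam C)\<^sup>s\<close> of a bounded set \<open>C\<close> to a covering sum. The case \<open>s = 0\<close> is
  separate because \<open>0 powr 0 = 0\<close>, whereas a nonempty set has to count \<open>1\<close>.\<close>

definition hausdorff_gauge :: "real \<Rightarrow> 'a::metric_space set \<Rightarrow> ennreal" where
  "hausdorff_gauge s C =
     (if C = {} then 0 else if s = 0 then 1 else ennreal (diameter C powr s))"

text \<open>Boundedness of the covering sets is required explicitly because \<open>diameter\<close> is meaningless
  for unbounded sets.\<close>

definition hausdorff_premeasure :: "real \<Rightarrow> real \<Rightarrow> 'a::metric_space set \<Rightarrow> ennreal" where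
  "hausdorff_premeasure s \<delta> A =
     (INF C \<in> {C :: nat \<Rightarrow> 'a set. A \<subseteq> (\<Union>i. C i) \<and> (\<forall>i. bounded (C i) \<and> diameter (C i) \<le> \<delta>)}.
        \<Sum>i. hausdorff_gauge s (C i))"

text \<open>No normalising constant is included; it does not affect the dimension.\<close>

definition hausdorff_measure :: "real \<Rightarrow> 'a::metric_space set \<Rightarrow> ennreal" where
  "hausdorff_measure s A = (SUP \<delta>\<in>{0<..}. hausdorff_premeasure s \<delta> A)"

text \<open>In particular the empty set has dimension \<open>0\<close>.\<close>

definition hausdorff_dim :: "'a::metric_space set \<Rightarrow> ereal" where
  "hausdorff_dim A = (INF s\<in>{s. 0 \<le> s \<and> hausdorff_measure s A = 0}. ereal s)"

end

theory Submission
  imports Defs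
begin

text \<open>Near the origin the planes \<open>V p\<close> are the graphs of linear maps \<open>M p\<close> from \<open>E = V 0\<close> to its orthogonal
complement, and \<open>M\<close> is Lipschitz (\<open>distribution_local_graph\<close>). The graph of a function \<open>f\<close> on a ball of
\<open>E\<close> with values in the complement is tangent to \<open>V\<close> over \<open>x\<close> iff \<open>f' x = M (x + f x)\<close>. So the task is to
find \<open>f\<close> of class \<open>C\<^sup>1\<^sup>,\<^sup>1\<close> that solves this differential equation exactly on a set of dimension \<open>d\<close>. The
equation is overdetermined and may have no solution on any open set, but it can be solved on
a Cantor set \<open>K\<close> with gaps proportional to the size of its cells, and such Cantor sets exist in every
dimension below \<open>k\<close> (\<open>exists_separated_digits\<close>): \<open>N\<close> cells of ratio \<open>r\<close>, with \<open>N r\<^sup>d = 1\<close>.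

On each cell of radius \<open>\<rho>\<close> let \<open>f\<close> follow an affine map whose slope is the value of \<open>M\<close> at the
centre of the cell. Passing from a cell to a child changes the slope by \<open>O(\<rho>)\<close>, and the change is carried
out by a cut-off function in an annulus of width comparable to \<open>\<rho>\<close>. Each transition therefore has second
derivatives of size \<open>O(1)\<close>, and the annuli of different levels are disjoint, so \<open>f\<close> is of class
\<open>C\<^sup>1\<^sup>,\<^sup>1\<close> (\<open>bump_sum'_lipschitz\<close>). At the points of \<open>K\<close> the slopes converge to the right value
(\<open>bump_sum'_on_cantor\<close>). The gaps make this work: \<open>K\<close> contains no curve along which a compatibility
condition for the slopes could fail.

There must be no tangency elsewhere. For this the slope on a cell of radius \<open>\<rho>\<close> is tilted: its entry for a
unit vector \<open>e\<close> of \<open>E\<close> and a unit vector \<open>\<nu>\<close> normal to \<open>E\<close> is increased by \<open>B \<rho>\<close>. The tilts tend to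
\<open>0\<close> on \<open>K\<close>. Off \<open>K\<close> only finitely many cells matter, and the tilt of the deepest one is
partly undone by the transition to its child, but since the cut-off decreases radially its derivative acts
in favour of the tilt (\<open>bump'_transversal\<close>), and \<open>r B \<rho>\<close> survives. The errors due to the variation of
\<open>M\<close> are \<open>O(\<rho>)\<close> with a constant independent of \<open>B\<close>. For large \<open>B\<close> that entry of \<open>f' x\<close> is thus
strictly larger than the entry of \<open>M (x + f x)\<close> at every \<open>x\<close> off \<open>K\<close> (\<open>bump_sum'_off_cantor\<close>).

The tangency set is thus the part of the graph over \<open>K\<close>. The cells bound its dimension from above; for
the lower bound \<open>K\<close> is parametrised by \<open>[0,1)\<close> through expansions in base \<open>N\<close>, and coverings are compared
with Lebesgue measure (\<open>hausdorff_dim_image_cantor\<close>).\<close>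

section \<open>Cut-off linear maps with Lipschitz derivative\<close>

text \<open>A quadratic spline in the variable \<open>s = \<bar>y\<bar>\<^sup>2\<close>: the second derivative is \<open>- 4/9\<close> on \<open>(1, 5/2)\<close>,
\<open>4/9\<close> on \<open>(5/2, 4)\<close> and \<open>0\<close> elsewhere. So the transition from \<open>1\<close> to \<open>0\<close> has a Lipschitz derivative, and
its derivative is piecewise linear, which reduces the bounds on it to linear arithmetic.\<close>

definition cutoff :: "real \<Rightarrow> real" where
  "cutoff s = 1 - 2 * (max 0 ((s - 1) / 3))\<^sup>2 + 4 * (max 0 ((s - 1) / 3 - 1 / 2))\<^sup>2
     - 2 * (max 0 ((s - 1) / 3 - 1))\<^sup>2"

definition cutoff' :: "real \<Rightarrow> real" where
  "cutoff' s = (- 4 * max 0 ((s - 1) / 3) + 8 * max 0 ((s - 1) / 3 - 1 / 2)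
     - 4 * max 0 ((s - 1) / 3 - 1)) / 3"

lemma max_0_power2_has_derivative:
  "((\<lambda>t::real. (max 0 t)\<^sup>2) has_real_derivative 2 * max 0 t) (at t)"
proof -
  consider "t > 0" | "t < 0" | "t = 0" by linarith
  then show ?thesis
  proof cases
    case 1
    have "((\<lambda>t::real. t\<^sup>2) has_real_derivative 2 * t) (at t)"
      by (auto intro!: derivative_eq_intros)
    then have "((\<lambda>t::real. (max 0 t)\<^sup>2) has_real_derivative 2 * t) (at t)"
      by (rule has_field_derivative_transform_within_open[of _ _ _ "{0<..}"]) (use 1 in auto)
    with 1 show ?thesis by simp
  next
    case 2
    have "((\<lambda>t::real. 0) has_real_derivative 0) (at t)" by simp
    then have "((\<lambda>t::real. (max 0 t)\<^sup>2) has_real_derivative 0) (at t)"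
      by (rule has_field_derivative_transform_within_open[of _ _ _ "{..<0}"]) (use 2 in auto)
    with 2 show ?thesis by simp
  next
    case 3
    have "((\<lambda>h. (max 0 h)\<^sup>2 / h) \<longlongrightarrow> 0) (at (0::real))"
    proof (rule Lim_null_comparison)
      have "norm ((max 0 h)\<^sup>2 / h) \<le> \<bar>h\<bar>" for h :: real
        by (auto simp: max_def power2_eq_square)
      then show "\<forall>\<^sub>F h in at 0. norm ((max 0 h)\<^sup>2 / h) \<le> \<bar>h::real\<bar>" by simp
      show "((\<lambda>h::real. \<bar>h\<bar>) \<longlongrightarrow> 0) (at 0)" by (auto intro!: tendsto_eq_intros)
    qed
    then show ?thesis using 3 by (simp add: DERIV_def)
  qed
qed

lemma cutoff_has_derivative: "(cutoff has_real_derivative cutoff' s) (at s)"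
proof -
  have *: "((\<lambda>s. (max 0 ((s - 1) / 3 - a))\<^sup>2) has_real_derivative 2 * max 0 ((s - 1) / 3 - a) / 3) (at s)"
    for a :: real
  proof -
    have "((\<lambda>s. (s - 1) / 3 - a) has_real_derivative 1 / 3) (at s)"
      by (auto intro!: derivative_eq_intros)
    from DERIV_chain2[OF max_0_power2_has_derivative this] show ?thesis by simp
  qed
  have "((\<lambda>s. 1 - 2 * (max 0 ((s - 1) / 3))\<^sup>2 + 4 * (max 0 ((s - 1) / 3 - 1 / 2))\<^sup>2
     - 2 * (max 0 ((s - 1) / 3 - 1))\<^sup>2) has_real_derivative cutoff' s) (at s)"
    unfolding cutoff'_def
    by (rule derivative_eq_intros *[of 0, simplified] * refl | simp)+
  then show ?thesis unfolding cutoff_def[abs_def] .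
qed

lemma cutoff_eq_1: "s \<le> 1 \<Longrightarrow> cutoff s = 1"
  and cutoff'_eq_0_inner: "s \<le> 1 \<Longrightarrow> cutoff' s = 0"
  by (auto simp: cutoff_def cutoff'_def max_def)

lemma cutoff_eq_0: "4 \<le> s \<Longrightarrow> cutoff s = 0"
  and cutoff'_eq_0_outer: "4 \<le> s \<Longrightarrow> cutoff' s = 0"
  by (auto simp: cutoff_def cutoff'_def max_def power2_eq_square field_simps)

lemma cutoff'_nonpos: "cutoff' s \<le> 0"
  and cutoff'_ge: "- 1 \<le> cutoff' s"
  by (auto simp: cutoff'_def max_def divide_simps)

lemma cutoff'_lipschitz: "\<bar>cutoff' s - cutoff' t\<bar> \<le> 2 * \<bar>s - t\<bar>"
  unfolding cutoff'_def by (simp add: max_def abs_if divide_simps)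

lemma cutoff_lipschitz: "\<bar>cutoff s - cutoff t\<bar> \<le> \<bar>s - t\<bar>"
proof -
  have "norm (cutoff s - cutoff t) \<le> 1 * norm (s - t)"
    using cutoff'_nonpos cutoff'_ge
    by (intro field_differentiable_bound[of UNIV])
       (force intro: has_field_derivative_at_within cutoff_has_derivative simp: abs_le_iff)+
  then show ?thesis by simp
qed

lemma cutoff_antimono: "s \<le> t \<Longrightarrow> cutoff t \<le> cutoff s"
  using DERIV_nonpos_imp_nonincreasing[of s t cutoff] cutoff_has_derivative cutoff'_nonpos by blast

lemma cutoff_nonneg: "0 \<le> cutoff s"
  using cutoff_antimono[of s "max s 4"] cutoff_eq_0[of "max s 4"] by simp

lemma cutoff_le_1: "cutoff s \<le> 1"
  using cutoff_antimono[of "min s 1" s] cutoff_eq_1[of "min s 1"] by simp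

definition rank_one :: "'a::real_inner \<Rightarrow> 'b::real_normed_vector \<Rightarrow> 'a \<Rightarrow>\<^sub>L 'b" where
  "rank_one e w = blinfun_scaleR_left w o\<^sub>L blinfun_inner_right e"

lemma rank_one_apply [simp]: "rank_one e w v = (e \<bullet> v) *\<^sub>R w"
  by (simp add: rank_one_def)

lemma norm_rank_one_le: "norm (rank_one e w) \<le> norm e * norm w"
proof (rule norm_blinfun_bound)
  show "norm (rank_one e w v) \<le> norm e * norm w * norm v" for v
    using mult_right_mono[OF Cauchy_Schwarz_ineq2[of e v], of "norm w"]
    by (simp add: mult_ac)
qed simp

text \<open>The linear map \<open>\<Delta>\<close> cut off outside the ball of radius \<open>2\<close>. Every correction to the graph is a rescaled
copy of this function, so the three estimates on \<open>bump\<close> below (size, size of the derivative,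
Lipschitz constant of the derivative) are all that regularity of the graph rests on.\<close>

definition bump :: "('a::euclidean_space \<Rightarrow>\<^sub>L 'b::euclidean_space) \<Rightarrow> 'a \<Rightarrow> 'b" where
  "bump \<Delta> y = cutoff (y \<bullet> y) *\<^sub>R \<Delta> y"

definition bump' :: "('a::euclidean_space \<Rightarrow>\<^sub>L 'b::euclidean_space) \<Rightarrow> 'a \<Rightarrow> 'a \<Rightarrow>\<^sub>L 'b" where
  "bump' \<Delta> y = cutoff (y \<bullet> y) *\<^sub>R \<Delta> + (2 * cutoff' (y \<bullet> y)) *\<^sub>R rank_one y (\<Delta> y)"

lemma bump_has_derivative: "(bump \<Delta> has_derivative bump' \<Delta> y) (at y)"
proof -
  have "((\<lambda>y. cutoff (y \<bullet> y)) has_derivative (\<lambda>h. cutoff' (y \<bullet> y) * (2 * (y \<bullet> h)))) (at y)"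
    by (rule has_derivative_eq_rhs[OF has_derivative_compose[OF _
          cutoff_has_derivative[THEN has_field_derivative_imp_has_derivative]]])
       (auto intro!: derivative_eq_intros simp: inner_commute)
  then show ?thesis unfolding bump_def[abs_def] bump'_def
    by (rule has_derivative_eq_rhs[OF has_derivative_scaleR])
       (auto intro!: derivative_eq_intros bounded_linear_imp_has_derivative
          simp: fun_eq_iff blinfun.bilinear_simps algebra_simps)
qed

lemma inner_self_le_1: "norm y \<le> 1 \<Longrightarrow> y \<bullet> y \<le> 1"
  by (simp add: dot_square_norm power_le_one)

lemma inner_self_ge_4: "2 \<le> norm y \<Longrightarrow> 4 \<le> y \<bullet> y"
  using power_mono[of 2 "norm y" 2] by (simp add: dot_square_norm)

lemma bump_inner: "norm y \<le> 1 \<Longrightarrow> bump \<Delta> y = \<Delta> y"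
  and bump'_inner: "norm y \<le> 1 \<Longrightarrow> bump' \<Delta> y = \<Delta>"
  using inner_self_le_1[of y]
  by (auto simp: bump_def bump'_def cutoff_eq_1 cutoff'_eq_0_inner)

lemma bump_outer: "2 \<le> norm y \<Longrightarrow> bump \<Delta> y = 0"
  and bump'_outer: "2 \<le> norm y \<Longrightarrow> bump' \<Delta> y = 0"
  using inner_self_ge_4[of y]
  by (auto simp: bump_def bump'_def cutoff_eq_0 cutoff'_eq_0_outer)

lemma norm_bump_le: "norm (bump \<Delta> y) \<le> 2 * norm \<Delta>"
proof (cases "norm y \<le> 2")
  case True
  have "norm (bump \<Delta> y) \<le> 1 * (norm \<Delta> * norm y)"
    unfolding bump_def norm_scaleR
    using cutoff_nonneg cutoff_le_1 by (intro mult_mono norm_blinfun) (auto simp: abs_le_iff)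
  also have "\<dots> \<le> norm \<Delta> * 2" using True by (simp add: mult_left_mono)
  finally show ?thesis by simp
qed (simp add: bump_outer)

lemma norm_rank_one_image_le:
  fixes \<Delta> :: "'a::euclidean_space \<Rightarrow>\<^sub>L 'b::euclidean_space"
  assumes y: "norm y \<le> 2"
  shows "norm (rank_one y (\<Delta> y)) \<le> 4 * norm \<Delta>"
proof -
  have "norm (rank_one y (\<Delta> y)) \<le> norm y * (norm \<Delta> * norm y)"
    using norm_rank_one_le[of y "\<Delta> y"] mult_left_mono[OF norm_blinfun[of \<Delta> y], of "norm y"] by simp
  also have "\<dots> \<le> 2 * (norm \<Delta> * 2)"
    using y by (intro mult_mono) auto
  finally show ?thesis by simp
qed

lemma norm_bump'_le_aux:
  assumes "norm y \<le> 2"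
  shows "norm (bump' \<Delta> y) \<le> (\<bar>cutoff (y \<bullet> y)\<bar> + 8 * \<bar>cutoff' (y \<bullet> y)\<bar>) * norm \<Delta>"
proof -
  have "norm (bump' \<Delta> y) \<le> \<bar>cutoff (y \<bullet> y)\<bar> * norm \<Delta> + \<bar>2 * cutoff' (y \<bullet> y)\<bar> * norm (rank_one y (\<Delta> y))"
    unfolding bump'_def by (rule order_trans[OF norm_triangle_ineq]) simp
  also have "\<dots> \<le> \<bar>cutoff (y \<bullet> y)\<bar> * norm \<Delta> + \<bar>2 * cutoff' (y \<bullet> y)\<bar> * (4 * norm \<Delta>)"
    using norm_rank_one_image_le[OF assms, of \<Delta>] by (intro add_left_mono mult_left_mono) auto
  finally show ?thesis by (simp add: algebra_simps abs_mult)
qed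

lemma norm_bump'_le: "norm (bump' \<Delta> y) \<le> 9 * norm \<Delta>"
proof (cases "norm y \<le> 2")
  case True
  have "\<bar>cutoff (y \<bullet> y)\<bar> + 8 * \<bar>cutoff' (y \<bullet> y)\<bar> \<le> 9"
    using cutoff_nonneg[of "y \<bullet> y"] cutoff_le_1[of "y \<bullet> y"] cutoff'_nonpos[of "y \<bullet> y"] cutoff'_ge[of "y \<bullet> y"]
    by linarith
  then show ?thesis
    using norm_bump'_le_aux[OF True, of \<Delta>] by (meson mult_right_mono norm_ge_zero order_trans)
qed (simp add: bump'_outer)

text \<open>A product estimate on the ball of radius \<open>2\<close>; outside it the function vanishes, and a pair of points
on different sides is handled by comparing with the value \<open>4\<close> of \<open>s\<close> on the bounding sphere, where
the spline and its derivative are \<open>0\<close>.\<close>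

lemma bump'_lipschitz: "norm (bump' \<Delta> y - bump' \<Delta> z) \<le> 100 * norm \<Delta> * norm (y - z)"
proof -
  have sq: "\<bar>y \<bullet> y - z \<bullet> z\<bar> \<le> 4 * norm (y - z)" if "norm y \<le> 2" "norm z \<le> 2" for y z :: 'a
  proof -
    have "y \<bullet> y - z \<bullet> z = (y + z) \<bullet> (y - z)" by (simp add: algebra_simps inner_commute)
    also have "\<bar>\<dots>\<bar> \<le> norm (y + z) * norm (y - z)" by (rule Cauchy_Schwarz_ineq2)
    also have "\<dots> \<le> 4 * norm (y - z)"
      using norm_triangle_ineq[of y z] that by (intro mult_right_mono) auto
    finally show ?thesis .
  qed
  have both: "norm (bump' \<Delta> y - bump' \<Delta> z) \<le> 100 * norm \<Delta> * norm (y - z)"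
    if yz: "norm y \<le> 2" "norm z \<le> 2" for y z :: 'a
  proof -
    let ?n = "norm (y - z)" and ?T = "\<lambda>y. rank_one y (\<Delta> y)"
    have T: "norm (?T y - ?T z) \<le> 4 * ?n * norm \<Delta>"
    proof -
      have "?T y - ?T z = rank_one (y - z) (\<Delta> y) + rank_one z (\<Delta> (y - z))"
        by (rule blinfun_eqI) (simp add: blinfun.bilinear_simps algebra_simps)
      also have "norm \<dots> \<le> norm (y - z) * norm (\<Delta> y) + norm z * norm (\<Delta> (y - z))"
        by (intro order_trans[OF norm_triangle_ineq] add_mono norm_rank_one_le)
      also have "\<dots> \<le> norm (y - z) * (norm \<Delta> * norm y) + norm z * (norm \<Delta> * norm (y - z))"
        by (intro add_mono mult_left_mono norm_blinfun) auto
      also have "\<dots> \<le> norm (y - z) * (norm \<Delta> * 2) + 2 * (norm \<Delta> * norm (y - z))"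
        using yz by (intro add_mono mult_left_mono mult_right_mono) auto
      finally show ?thesis by (simp add: algebra_simps)
    qed
    have c: "\<bar>cutoff (y \<bullet> y) - cutoff (z \<bullet> z)\<bar> \<le> 4 * ?n"
      using cutoff_lipschitz[of "y \<bullet> y" "z \<bullet> z"] sq[OF yz] by linarith
    have c': "\<bar>cutoff' (y \<bullet> y) - cutoff' (z \<bullet> z)\<bar> \<le> 8 * ?n"
      using order_trans[OF cutoff'_lipschitz mult_left_mono[OF sq[OF yz], of 2]] by simp
    have "bump' \<Delta> y - bump' \<Delta> z = (cutoff (y \<bullet> y) - cutoff (z \<bullet> z)) *\<^sub>R \<Delta>
        + 2 *\<^sub>R (cutoff' (y \<bullet> y) *\<^sub>R (?T y - ?T z))
        + 2 *\<^sub>R ((cutoff' (y \<bullet> y) - cutoff' (z \<bullet> z)) *\<^sub>R ?T z)"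
      by (rule blinfun_eqI) (simp add: bump'_def blinfun.bilinear_simps algebra_simps)
    also have "norm \<dots> \<le> \<bar>cutoff (y \<bullet> y) - cutoff (z \<bullet> z)\<bar> * norm \<Delta>
        + 2 * (\<bar>cutoff' (y \<bullet> y)\<bar> * norm (?T y - ?T z))
        + 2 * (\<bar>cutoff' (y \<bullet> y) - cutoff' (z \<bullet> z)\<bar> * norm (?T z))"
      by (intro order_trans[OF norm_triangle_ineq] add_mono)
         (simp_all only: norm_scaleR abs_numeral order_refl)
    also have "\<dots> \<le> 4 * ?n * norm \<Delta> + 2 * (1 * (4 * ?n * norm \<Delta>)) + 2 * (8 * ?n * (4 * norm \<Delta>))"
      using c c' T norm_rank_one_image_le[OF yz(2), of \<Delta>] cutoff'_nonpos[of "y \<bullet> y"] cutoff'_ge[of "y \<bullet> y"]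
      by (intro add_mono mult_left_mono mult_mono) auto
    also have "\<dots> = 76 * norm \<Delta> * norm (y - z)" by simp
    also have "\<dots> \<le> 100 * norm \<Delta> * norm (y - z)" by (intro mult_right_mono) auto
    finally show ?thesis .
  qed
  have mixed: "norm (bump' \<Delta> z) \<le> 100 * norm \<Delta> * norm (y - z)"
    if yz: "2 \<le> norm y" "norm z \<le> 2" for y z :: 'a
  proof -
    have zz: "z \<bullet> z \<le> 4" using power_mono[of "norm z" 2 2] yz by (simp add: dot_square_norm)
    have "4 - z \<bullet> z = (2 - norm z) * (2 + norm z)"
      by (simp add: dot_square_norm power2_eq_square algebra_simps)
    also have "\<dots> \<le> (2 - norm z) * 4" using yz by (intro mult_left_mono) auto
    also have "\<dots> \<le> 4 * norm (y - z)" using norm_triangle_ineq2[of y z] yz by simp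
    finally have s: "4 - z \<bullet> z \<le> 4 * norm (y - z)" .
    have "\<bar>cutoff (z \<bullet> z)\<bar> \<le> 4 - z \<bullet> z" "\<bar>cutoff' (z \<bullet> z)\<bar> \<le> 2 * (4 - z \<bullet> z)"
      using cutoff_lipschitz[of "z \<bullet> z" 4] cutoff'_lipschitz[of "z \<bullet> z" 4] zz
      by (simp_all add: cutoff_eq_0 cutoff'_eq_0_outer)
    then have "\<bar>cutoff (z \<bullet> z)\<bar> + 8 * \<bar>cutoff' (z \<bullet> z)\<bar> \<le> 100 * norm (y - z)"
      using s norm_ge_zero[of "y - z"] by argo
    then have "norm (bump' \<Delta> z) \<le> 100 * norm (y - z) * norm \<Delta>"
      using norm_bump'_le_aux[OF yz(2), of \<Delta>] by (meson mult_right_mono norm_ge_zero order_trans)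
    then show ?thesis by (simp add: mult_ac)
  qed
  consider "norm y \<le> 2" "norm z \<le> 2" | "2 \<le> norm y" "norm z \<le> 2" | "norm y \<le> 2" "2 \<le> norm z"
    | "2 \<le> norm y" "2 \<le> norm z" by linarith
  then show ?thesis
    using both[of y z] mixed[of y z] mixed[of z y]
    by cases (auto simp: bump'_outer norm_minus_commute)
qed

section \<open>Nested cells and their Cantor set\<close>

text \<open>A self-similar Cantor set is described by its ratio \<open>r\<close> and the centres \<open>D\<close> of the first-generation
cells, relative to the unit ball. A word lists the choices from last to first, so that \<open>a # w\<close> is a
child of \<open>w\<close>. The last two conditions leave room for the cut-off functions: the ball of twice the radius
around a child still lies in the parent cell, and these doubled balls are far apart from each other
compared with their size.\<close>

locale cell_system =
  fixes D :: "'a::euclidean_space set" and r \<epsilon> :: real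
  assumes finite_D: "finite D"
    and r_pos: "0 < r" and r_le: "r \<le> 1 / 2" and \<epsilon>_pos: "0 < \<epsilon>"
    and D_norm: "a \<in> D \<Longrightarrow> norm a + 2 * r \<le> 1"
    and D_separated: "a \<in> D \<Longrightarrow> b \<in> D \<Longrightarrow> a \<noteq> b \<Longrightarrow> 6 * r \<le> norm (a - b)"
begin

definition radius :: "nat \<Rightarrow> real" where
  "radius j = \<epsilon> * r ^ j"

primrec centre :: "'a list \<Rightarrow> 'a" where
  "centre [] = 0"
| "centre (a # w) = centre w + radius (length w) *\<^sub>R a"

definition words :: "nat \<Rightarrow> 'a list set" where
  "words j = {w. set w \<subseteq> D \<and> length w = j}"

definition cantor :: "'a set" where
  "cantor = {x. \<forall>j. \<exists>w\<in>words j. norm (x - centre w) \<le> radius j}"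

lemma radius_0 [simp]: "radius 0 = \<epsilon>"
  and radius_Suc: "radius (Suc j) = r * radius j"
  by (simp_all add: radius_def)

lemma radius_pos: "0 < radius j"
  using \<epsilon>_pos r_pos by (simp add: radius_def)

lemma radius_nonneg: "0 \<le> radius j"
  using radius_pos[of j] by simp

lemma radius_Suc_le: "radius (Suc j) \<le> radius j / 2"
  using mult_right_mono[OF r_le, of "radius j"] radius_pos[of j] by (simp add: radius_Suc)

lemma radius_le: "radius j \<le> \<epsilon>"
proof (induction j)
  case (Suc j)
  then show ?case using radius_Suc_le[of j] radius_pos[of j] by linarith
qed simp

lemma radius_tendsto_0: "radius \<longlonglongrightarrow> 0"
  unfolding radius_def[abs_def] using r_pos r_le
  by (auto intro!: tendsto_eq_intros LIMSEQ_realpow_zero)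

lemma radius_sums: "radius sums (\<epsilon> / (1 - r))"
  using sums_mult[OF geometric_sums[of r], of \<epsilon>] r_pos r_le by (simp add: radius_def[abs_def])

lemma words_0 [simp]: "words 0 = {[]}"
  by (auto simp: words_def)

lemma Cons_in_words_iff: "a # w \<in> words j \<longleftrightarrow> a \<in> D \<and> (\<exists>i. j = Suc i \<and> w \<in> words i)"
  by (auto simp: words_def)

lemma words_Suc_cases:
  assumes "u \<in> words (Suc j)"
  obtains a w where "u = a # w" "a \<in> D" "w \<in> words j"
  using assms by (cases u) (auto simp: words_def)

lemma length_words: "w \<in> words j \<Longrightarrow> length w = j"
  by (simp add: words_def)

lemma finite_words: "finite (words j)"
  using finite_lists_length_eq[OF finite_D] by (simp add: words_def)

lemma card_words: "card (words j) = card D ^ j"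
  using card_lists_length_eq[OF finite_D] by (simp add: words_def)

lemma D_norm_le_1: "a \<in> D \<Longrightarrow> norm a \<le> 1"
  using D_norm[of a] r_pos by linarith

lemma cell_nested:
  assumes "a \<in> D" "w \<in> words j" "norm (x - centre (a # w)) \<le> 2 * radius (Suc j)"
  shows "norm (x - centre w) \<le> radius j"
proof -
  have "x - centre w = (x - centre (a # w)) + radius j *\<^sub>R a"
    using assms by (simp add: length_words)
  then have "norm (x - centre w) \<le> norm (x - centre (a # w)) + norm (radius j *\<^sub>R a)"
    by (metis norm_triangle_ineq)
  also have "\<dots> \<le> 2 * radius (Suc j) + radius j * norm a"
    using assms(3) radius_pos[of j] by simp
  also have "\<dots> = radius j * (norm a + 2 * r)" by (simp add: radius_Suc algebra_simps)
  also have "\<dots> \<le> radius j" using mult_left_mono[OF D_norm[OF assms(1)] radius_nonneg[of j]] by simp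
  finally show ?thesis .
qed

lemma ancestor_cell:
  assumes "i < j" "u \<in> words j" "norm (x - centre u) \<le> 2 * radius j"
  shows "\<exists>w\<in>words i. norm (x - centre w) \<le> radius i"
  using assms
proof (induction j arbitrary: u)
  case (Suc j)
  obtain a w where u: "u = a # w" "a \<in> D" "w \<in> words j"
    using Suc.prems words_Suc_cases by blast
  have w: "norm (x - centre w) \<le> radius j"
    using cell_nested Suc.prems u by blast
  show ?case
  proof (cases "i = j")
    case False
    then show ?thesis using Suc.IH[of w] Suc.prems u w radius_pos[of j] by simp
  qed (use u w in auto)
qed simp

lemma centre_separated:
  assumes "u \<in> words j" "w \<in> words j" "u \<noteq> w"
  shows "6 * radius j \<le> norm (centre u - centre w)"
  using assms
proof (induction j arbitrary: u w)
  case (Suc j)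
  obtain a u' where u: "u = a # u'" "a \<in> D" "u' \<in> words j"
    using Suc.prems words_Suc_cases by blast
  obtain b w' where w: "w = b # w'" "b \<in> D" "w' \<in> words j"
    using Suc.prems words_Suc_cases by blast
  have eq: "centre u - centre w = (centre u' - centre w') - radius j *\<^sub>R (b - a)"
    using u w by (simp add: length_words algebra_simps)
  show ?case
  proof (cases "u' = w'")
    case True
    then have "6 * r \<le> norm (b - a)"
      using D_separated[of b a] u w Suc.prems by auto
    then show ?thesis
      using eq True mult_left_mono[of "6 * r" "norm (b - a)" "radius j"] radius_pos[of j]
      by (simp add: radius_Suc mult_ac)
  next
    case False
    have "norm (b - a) \<le> 2"
      using norm_triangle_ineq4[of b a] D_norm_le_1[OF u(2)] D_norm_le_1[OF w(2)] by linarith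
    then have "norm (radius j *\<^sub>R (b - a)) \<le> 2 * radius j"
      using mult_left_mono[of "norm (b - a)" 2 "radius j"] radius_pos[of j] by simp
    moreover have "6 * radius j \<le> norm (centre u' - centre w')"
      using Suc.IH u w False by blast
    ultimately show ?thesis
      unfolding eq using norm_triangle_ineq2[of "centre u' - centre w'" "radius j *\<^sub>R (b - a)"]
        radius_Suc_le[of j] radius_pos[of j] by linarith
  qed
qed simp

lemma same_cell:
  assumes "u \<in> words j" "w \<in> words j" "norm (x - centre u) \<le> 2 * radius j"
    "norm (y - centre w) \<le> 2 * radius j" "norm (x - y) < 2 * radius j"
  shows "u = w"
proof (rule ccontr)
  assume "u \<noteq> w"
  then have "6 * radius j \<le> norm (centre u - centre w)"
    using centre_separated assms by blast
  moreover have "centre u - centre w = (x - y) - (x - centre u) + (y - centre w)" by simp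
  then have "norm (centre u - centre w) \<le> norm (x - y) + norm (x - centre u) + norm (y - centre w)"
    using norm_triangle_ineq4[of "x - y" "x - centre u"]
      norm_triangle_ineq[of "(x - y) - (x - centre u)" "y - centre w"] by simp
  ultimately show False using assms by linarith
qed

text \<open>Geometric decay: the radii below a threshold \<open>t\<close> add up to at most \<open>2 * t\<close>. In the Lipschitz estimate
\<open>t\<close> is the distance of two points, and these are the scales too fine to be compared at the points.\<close>

lemma sum_radius_le: "(\<Sum>j<n. if radius j \<le> t then radius j else 0) \<le> 2 * t" if "0 \<le> t"
proof -
  have "(\<Sum>j<n. if c * r ^ j \<le> t then c * r ^ j else 0) \<le> 2 * t" if "0 \<le> t" "0 < c" for c t
    using that
  proof (induction n arbitrary: c t)
    case (Suc n)
    have split: "(\<Sum>j<Suc n. if c * r ^ j \<le> t then c * r ^ j else 0)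
      = (if c \<le> t then c else 0) + (\<Sum>j<n. if (c * r) * r ^ j \<le> t then (c * r) * r ^ j else 0)"
      by (subst sum.lessThan_Suc_shift) (simp add: mult.assoc cong: if_cong)
    show ?case
    proof (cases "c \<le> t")
      case True
      have "(c * r) * r ^ j \<le> c * r" for j
        using r_pos r_le Suc.prems by (simp add: mult_left_le power_le_one)
      then have "(\<Sum>j<n. if (c * r) * r ^ j \<le> t then (c * r) * r ^ j else 0)
          \<le> (\<Sum>j<n. if (c * r) * r ^ j \<le> c * r then (c * r) * r ^ j else 0)"
        using r_pos Suc.prems by (intro sum_mono) auto
      also have "\<dots> \<le> 2 * (c * r)" using Suc.prems r_pos by (intro Suc.IH) auto
      also have "\<dots> \<le> c" using mult_left_mono[OF r_le, of c] Suc.prems by simp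
      finally show ?thesis using split True by simp
    next
      case False
      then show ?thesis using split Suc.IH[of t "c * r"] Suc.prems r_pos by simp
    qed
  qed simp
  then show ?thesis using that \<epsilon>_pos by (simp add: radius_def cong: if_cong)
qed

lemma series_tail_le:
  fixes a :: "nat \<Rightarrow> 'c::banach"
  assumes a: "\<And>i. norm (a i) \<le> K * radius i" and K: "0 \<le> K"
  shows "norm (suminf a - (\<Sum>i\<le>j. a i)) \<le> K * radius j"
proof -
  have sumr: "summable (\<lambda>i. K * radius i)"
    using radius_sums by (intro summable_mult) (auto simp: sums_iff)
  then have suma: "summable a" by (rule summable_comparison_test') (use a in auto)
  have "suminf a - (\<Sum>i\<le>j. a i) = (\<Sum>i. a (i + Suc j))"
    using suminf_split_initial_segment[OF suma, of "Suc j"] by (simp add: lessThan_Suc_atMost)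
  also have "norm \<dots> \<le> (\<Sum>i. K * radius (i + Suc j))"
    using a sumr by (intro norm_suminf_le) (auto simp: summable_iff_shift simp del: add_Suc_right)
  also have "\<dots> = (\<Sum>i. (K * radius (Suc j)) * r ^ i)"
    by (simp add: radius_def power_add mult_ac)
  also have "\<dots> = K * (radius (Suc j) / (1 - r))"
    using r_pos r_le by (subst suminf_mult) (auto simp: suminf_geometric summable_geometric)
  also have "\<dots> \<le> K * radius j"
  proof (intro mult_left_mono K)
    have "radius j * r \<le> radius j * (1 - r)"
      using r_le radius_pos[of j] by (intro mult_left_mono) auto
    then show "radius (Suc j) / (1 - r) \<le> radius j"
      using r_le r_pos by (simp add: radius_Suc divide_le_eq mult_ac)
  qed
  finally show ?thesis .
qed

end

section \<open>Sums of bumps over the cells\<close>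

text \<open>One linear map \<open>\<Delta> w\<close> per cell, of size at most a multiple of the radius of the cell. The sum of the
corresponding bumps then has bounded second derivatives in the sense of Lipschitz constants, because at a
given point at most one level is in the middle of a transition.\<close>

locale bump_series = cell_system D r \<epsilon> for D :: "'a::euclidean_space set" and r \<epsilon> +
  fixes \<Delta> :: "'a list \<Rightarrow> 'a \<Rightarrow>\<^sub>L 'b::euclidean_space" and H :: real
  assumes norm_\<Delta>_le: "w \<in> words j \<Longrightarrow> norm (\<Delta> w) \<le> H * radius j"
begin

definition word_bump :: "'a list \<Rightarrow> 'a \<Rightarrow> 'b" where
  "word_bump w x = radius (length w) *\<^sub>R bump (\<Delta> w) ((x - centre w) /\<^sub>R radius (length w))"

definition word_bump' :: "'a list \<Rightarrow> 'a \<Rightarrow> 'a \<Rightarrow>\<^sub>L 'b" where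
  "word_bump' w x = bump' (\<Delta> w) ((x - centre w) /\<^sub>R radius (length w))"

definition level_bump :: "nat \<Rightarrow> 'a \<Rightarrow> 'b" where
  "level_bump j x = (\<Sum>w\<in>words j. word_bump w x)"

definition level_bump' :: "nat \<Rightarrow> 'a \<Rightarrow> 'a \<Rightarrow>\<^sub>L 'b" where
  "level_bump' j x = (\<Sum>w\<in>words j. word_bump' w x)"

definition bump_sum :: "'a \<Rightarrow> 'b" where
  "bump_sum x = (\<Sum>j. level_bump j x)"

definition bump_sum' :: "'a \<Rightarrow> 'a \<Rightarrow>\<^sub>L 'b" where
  "bump_sum' x = (\<Sum>j. level_bump' j x)"

lemma H_nonneg: "0 \<le> H"
proof -
  have "0 \<le> H * \<epsilon>" using order_trans[OF norm_ge_zero norm_\<Delta>_le[of "[]" 0]] by simp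
  then show ?thesis using \<epsilon>_pos by (simp add: zero_le_mult_iff)
qed

lemma word_bump_has_derivative: "(word_bump w has_derivative word_bump' w x) (at x)"
proof -
  have "((\<lambda>x. (x - centre w) /\<^sub>R radius (length w)) has_derivative (\<lambda>h. h /\<^sub>R radius (length w))) (at x)"
    by (auto intro!: derivative_eq_intros)
  from has_derivative_scaleR_right[OF has_derivative_compose[OF this bump_has_derivative],
      of "radius (length w)" "\<Delta> w"]
  show ?thesis
    using radius_pos[of "length w"]
    by (simp add: word_bump_def[abs_def] word_bump'_def blinfun.bilinear_simps)
qed

lemma word_bump_outer:
  assumes "w \<in> words j" "2 * radius j \<le> norm (x - centre w)"
  shows "word_bump w x = 0" "word_bump' w x = 0"
proof -
  have "norm ((x - centre w) /\<^sub>R radius (length w)) = norm (x - centre w) / radius j"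
    using assms radius_pos[of j] by (simp add: length_words divide_inverse_commute)
  then have "2 \<le> norm ((x - centre w) /\<^sub>R radius (length w))"
    using assms radius_pos[of j] by (simp add: le_divide_eq)
  then show "word_bump w x = 0" "word_bump' w x = 0"
    by (simp_all add: word_bump_def word_bump'_def bump_outer bump'_outer)
qed

lemma word_bump_inner:
  assumes "w \<in> words j" "norm (x - centre w) \<le> radius j"
  shows "word_bump w x = \<Delta> w (x - centre w)" "word_bump' w x = \<Delta> w"
proof -
  have "norm ((x - centre w) /\<^sub>R radius (length w)) = norm (x - centre w) / radius j"
    using assms radius_pos[of j] by (simp add: length_words divide_inverse_commute)
  then have "norm ((x - centre w) /\<^sub>R radius (length w)) \<le> 1"
    using assms radius_pos[of j] by (simp add: divide_le_eq)
  then show "word_bump w x = \<Delta> w (x - centre w)" "word_bump' w x = \<Delta> w"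
    using radius_pos[of "length w"]
    by (simp_all add: word_bump_def word_bump'_def bump_inner bump'_inner blinfun.bilinear_simps)
qed

lemma level_bump_eq_word_bump:
  assumes "w \<in> words j" "norm (x - centre w) \<le> 4 * radius j"
  shows "level_bump j x = word_bump w x" "level_bump' j x = word_bump' w x"
proof -
  have far: "2 * radius j \<le> norm (x - centre u)" if "u \<in> words j - {w}" for u
  proof -
    have "6 * radius j \<le> norm (centre u - centre w)"
      using centre_separated[of u j w] that assms by auto
    also have "\<dots> = norm ((x - centre w) - (x - centre u))" by simp
    also have "\<dots> \<le> norm (x - centre w) + norm (x - centre u)" by (rule norm_triangle_ineq4)
    finally show ?thesis using assms by linarith
  qed
  show "level_bump j x = word_bump w x" "level_bump' j x = word_bump' w x"
    unfolding level_bump_def level_bump'_def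
    using assms finite_words word_bump_outer(1)[OF _ far] word_bump_outer(2)[OF _ far]
    by (simp_all add: sum.remove)
qed

lemma level_bump_eq_0:
  assumes "\<And>w. w \<in> words j \<Longrightarrow> 2 * radius j \<le> norm (x - centre w)"
  shows "level_bump j x = 0" "level_bump' j x = 0"
  using assms word_bump_outer by (simp_all add: level_bump_def level_bump'_def)

lemma norm_level_bump_le:
  assumes "\<And>w. w \<in> words j \<Longrightarrow> norm (\<Delta> w) \<le> C" "0 \<le> C"
  shows "norm (level_bump j x) \<le> 2 * C * radius j" "norm (level_bump' j x) \<le> 9 * C"
proof -
  have "norm (level_bump j x) \<le> 2 * C * radius j \<and> norm (level_bump' j x) \<le> 9 * C"
  proof (cases "\<exists>w\<in>words j. norm (x - centre w) < 2 * radius j")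
    case True
    then obtain w where w: "w \<in> words j" "norm (x - centre w) < 2 * radius j" by blast
    have le: "norm (\<Delta> w) \<le> C" using assms w by blast
    have "level_bump j x = word_bump w x" "level_bump' j x = word_bump' w x"
      using level_bump_eq_word_bump[of w j x] w radius_pos[of j] by auto
    moreover have "norm (word_bump w x) \<le> 2 * C * radius j"
      using mult_left_mono[OF order_trans[OF norm_bump_le mult_left_mono[OF le, of 2]], of "radius j"]
        w radius_pos[of j]
      by (simp add: word_bump_def length_words mult_ac)
    moreover have "norm (word_bump' w x) \<le> 9 * C"
      using order_trans[OF norm_bump'_le mult_left_mono[OF le, of 9]] by (simp add: word_bump'_def)
    ultimately show ?thesis by simp
  next
    case False
    then show ?thesis using level_bump_eq_0[of j x] assms radius_pos[of j] by (auto simp: not_less)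
  qed
  then show "norm (level_bump j x) \<le> 2 * C * radius j" "norm (level_bump' j x) \<le> 9 * C" by auto
qed

lemma norm_level_bump'_le: "norm (level_bump' j x) \<le> 9 * H * radius j"
  using norm_level_bump_le(2)[of j "H * radius j" x] norm_\<Delta>_le H_nonneg radius_nonneg by simp

lemma norm_level_bump_le_radius: "norm (level_bump j x) \<le> 2 * H * \<epsilon> * radius j"
proof -
  have "norm (level_bump j x) \<le> 2 * (H * radius j) * radius j"
    using norm_level_bump_le(1)[of j "H * radius j" x] norm_\<Delta>_le H_nonneg radius_nonneg by simp
  also have "\<dots> \<le> 2 * (H * \<epsilon>) * radius j"
    using H_nonneg radius_nonneg radius_le by (intro mult_right_mono mult_left_mono) auto
  finally show ?thesis by simp
qed

lemma summable_level_bump: "summable (\<lambda>j. level_bump j x)"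
proof (rule summable_comparison_test')
  show "summable (\<lambda>j. 2 * H * \<epsilon> * radius j)"
    using radius_sums by (intro summable_mult) (auto simp: sums_iff)
qed (use norm_level_bump_le_radius in auto)

lemma summable_level_bump': "summable (\<lambda>j. level_bump' j x)"
proof (rule summable_comparison_test')
  show "summable (\<lambda>j. 9 * H * radius j)"
    using radius_sums by (intro summable_mult) (auto simp: sums_iff)
qed (use norm_level_bump'_le in auto)

definition annulus :: "nat \<Rightarrow> 'a \<Rightarrow> bool" where
  "annulus j x \<longleftrightarrow> (\<exists>w\<in>words j. radius j < norm (x - centre w) \<and> norm (x - centre w) < 2 * radius j)"

text \<open>A point in the doubled ball of a cell lies in the undoubled balls of all ancestors of that cell. So it is
in the transition zone of at most one level; this is what keeps the second derivatives
of the individual levels from adding up.\<close>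

lemma annulus_level_unique:
  assumes "annulus i x" "annulus j x"
  shows "i = j"
proof -
  have False if "i < j" "annulus i x" "annulus j x" for i j :: nat
  proof -
    obtain u where "u \<in> words j" "norm (x - centre u) < 2 * radius j"
      using \<open>annulus j x\<close> unfolding annulus_def by auto
    then obtain w where w: "w \<in> words i" "norm (x - centre w) \<le> radius i"
      using ancestor_cell[of i j u x] \<open>i < j\<close> by auto
    obtain v where v: "v \<in> words i" "radius i < norm (x - centre v)" "norm (x - centre v) < 2 * radius i"
      using \<open>annulus i x\<close> unfolding annulus_def by auto
    have "v = w" using same_cell[of v i w x x] v w radius_pos[of i] by simp
    then show False using v w by simp
  qed
  then show ?thesis using assms by (meson linorder_neqE_nat)
qed

lemma sum_annulus_le_1: "(\<Sum>j<n. of_bool (annulus j x) :: real) \<le> 1"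
proof -
  have "(\<Sum>j<n. of_bool (annulus j x) :: real) = of_nat (card {j. j < n \<and> annulus j x})"
    by (simp add: sum_of_bool_eq lessThan_def Int_def)
  moreover have "card {j. j < n \<and> annulus j x} \<le> 1"
    using annulus_level_unique by (auto simp: card_le_Suc0_iff_eq)
  ultimately show ?thesis by simp
qed

lemma word_bump'_lipschitz:
  assumes "w \<in> words j"
  shows "norm (word_bump' w x - word_bump' w y) \<le> 100 * H * norm (x - y)"
proof -
  have "norm (word_bump' w x - word_bump' w y)
      \<le> 100 * norm (\<Delta> w) * norm ((x - centre w) /\<^sub>R radius j - (y - centre w) /\<^sub>R radius j)"
    unfolding word_bump'_def length_words[OF assms] by (rule bump'_lipschitz)
  also have "(x - centre w) /\<^sub>R radius j - (y - centre w) /\<^sub>R radius j = (x - y) /\<^sub>R radius j"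
    by (simp add: algebra_simps)
  also have "100 * norm (\<Delta> w) * norm ((x - y) /\<^sub>R radius j)
      \<le> 100 * (H * radius j) * norm ((x - y) /\<^sub>R radius j)"
    using norm_\<Delta>_le[OF assms] by (intro mult_right_mono mult_left_mono) auto
  also have "\<dots> = 100 * H * norm (x - y)" using radius_pos[of j] by simp
  finally show ?thesis .
qed

text \<open>Levels finer than \<open>norm (x - y)\<close> are estimated by their size. At coarser levels both points see the same
cell, and unless one of them is in the transition zone the derivative is the same constant at both.\<close>

lemma level_bump'_diff_le:
  "norm (level_bump' j x - level_bump' j y)
    \<le> 100 * H * norm (x - y) * (of_bool (annulus j x) + of_bool (annulus j y))
      + 18 * H * (if radius j \<le> norm (x - y) then radius j else 0)"
proof (cases "radius j \<le> norm (x - y)")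
  case True
  have "norm (level_bump' j x - level_bump' j y) \<le> 18 * H * radius j"
    using norm_triangle_ineq4[of "level_bump' j x" "level_bump' j y"]
      norm_level_bump'_le[of j x] norm_level_bump'_le[of j y] by linarith
  then show ?thesis using True H_nonneg by (simp add: add_increasing)
next
  case False
  show ?thesis
  proof (cases "\<exists>w\<in>words j. norm (x - centre w) < 2 * radius j \<or> norm (y - centre w) < 2 * radius j")
    case True
    then obtain w where w: "w \<in> words j"
      and near: "norm (x - centre w) < 2 * radius j \<or> norm (y - centre w) < 2 * radius j" by blast
    have tri: "norm (x - centre w) \<le> norm (x - y) + norm (y - centre w)"
      "norm (y - centre w) \<le> norm (x - y) + norm (x - centre w)"
      using norm_triangle_ineq[of "x - y" "y - centre w"] norm_triangle_ineq[of "y - x" "x - centre w"]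
      by (simp_all add: norm_minus_commute)
    have "norm (x - centre w) \<le> 4 * radius j" "norm (y - centre w) \<le> 4 * radius j"
      using near tri False radius_pos[of j] by linarith+
    then have eq: "level_bump' j x = word_bump' w x" "level_bump' j y = word_bump' w y"
      using level_bump_eq_word_bump[OF w] by auto
    show ?thesis
    proof (cases "annulus j x \<or> annulus j y")
      case True
      have "norm (level_bump' j x - level_bump' j y) \<le> 100 * H * norm (x - y) * 1"
        using word_bump'_lipschitz[OF w] eq by simp
      also have "\<dots> \<le> 100 * H * norm (x - y) * (of_bool (annulus j x) + of_bool (annulus j y))"
        using True H_nonneg by (intro mult_left_mono) auto
      finally show ?thesis using False by simp
    next
      case nowhere: False
      have "norm (x - centre w) \<le> radius j" "norm (y - centre w) \<le> radius j"
        using nowhere near tri False w radius_pos[of j] unfolding annulus_def by force+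
      then show ?thesis using eq word_bump_inner(2)[OF w] nowhere False by simp
    qed
  next
    case nowhere: False
    then have "level_bump' j x = 0" "level_bump' j y = 0"
      by (auto intro!: level_bump_eq_0 simp: not_less)
    then show ?thesis using H_nonneg False by simp
  qed
qed

lemma bump_sum'_lipschitz: "norm (bump_sum' x - bump_sum' y) \<le> 236 * H * norm (x - y)"
proof (rule LIMSEQ_le_const2)
  show "(\<lambda>n. norm ((\<Sum>j<n. level_bump' j x) - (\<Sum>j<n. level_bump' j y)))
      \<longlonglongrightarrow> norm (bump_sum' x - bump_sum' y)"
    unfolding bump_sum'_def
    by (intro tendsto_norm tendsto_diff summable_LIMSEQ summable_level_bump')
  have "norm ((\<Sum>j<n. level_bump' j x) - (\<Sum>j<n. level_bump' j y)) \<le> 236 * H * norm (x - y)" for n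
  proof -
    let ?t = "norm (x - y)"
    have "norm ((\<Sum>j<n. level_bump' j x) - (\<Sum>j<n. level_bump' j y))
        \<le> (\<Sum>j<n. norm (level_bump' j x - level_bump' j y))"
      unfolding sum_subtractf[symmetric] by (rule norm_sum)
    also have "\<dots> \<le> (\<Sum>j<n. 100 * H * ?t * (of_bool (annulus j x) + of_bool (annulus j y))
        + 18 * H * (if radius j \<le> ?t then radius j else 0))"
      by (intro sum_mono level_bump'_diff_le)
    also have "\<dots> = 100 * H * ?t * ((\<Sum>j<n. of_bool (annulus j x)) + (\<Sum>j<n. of_bool (annulus j y)))
        + 18 * H * (\<Sum>j<n. if radius j \<le> ?t then radius j else 0)"
      by (simp add: sum.distrib sum_distrib_left distrib_left del: sum_of_bool_eq)
    also have "\<dots> \<le> 100 * H * ?t * (1 + 1) + 18 * H * (2 * ?t)"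
      using H_nonneg sum_radius_le[of ?t] by (intro add_mono mult_left_mono sum_annulus_le_1) auto
    finally show ?thesis by simp
  qed
  then show "\<exists>N. \<forall>n\<ge>N. norm ((\<Sum>j<n. level_bump' j x) - (\<Sum>j<n. level_bump' j y))
      \<le> 236 * H * norm (x - y)" by blast
qed

lemma bump_sum_has_derivative: "(bump_sum has_derivative bump_sum' x) (at x)"
proof -
  have "\<exists>g. \<forall>x\<in>UNIV. (\<lambda>n. level_bump n x) sums g x \<and> (g has_derivative bump_sum' x) (at x within UNIV)"
  proof (rule has_derivative_series)
    show "(level_bump n has_derivative level_bump' n x) (at x within UNIV)" for n x
      unfolding level_bump_def[abs_def] level_bump'_def blinfun.sum_left
      by (intro has_derivative_sum) (simp add: word_bump_has_derivative)
    show "(\<lambda>n. level_bump n 0) sums suminf (\<lambda>n. level_bump n 0)"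
      by (intro summable_sums summable_level_bump)
    fix e :: real assume "e > 0"
    have "(\<lambda>j. 9 * H * radius j) \<longlonglongrightarrow> 0"
      by (auto intro!: tendsto_eq_intros radius_tendsto_0)
    then obtain N where N: "\<And>j. j \<ge> N \<Longrightarrow> 9 * H * radius j < e"
      using order_tendstoD(2)[of "\<lambda>j. 9 * H * radius j" 0 sequentially e] \<open>e > 0\<close>
      unfolding eventually_sequentially by blast
    have "norm ((\<Sum>i<n. level_bump' i x h) - bump_sum' x h) \<le> e * norm h" if "n \<ge> Suc N" for n x h
    proof -
      have "n = Suc (n - 1)" "n - 1 \<ge> N" using that by auto
      then obtain j where j: "n = Suc j" "j \<ge> N" by blast
      have "norm ((\<Sum>i<n. level_bump' i x h) - bump_sum' x h)
          = norm ((bump_sum' x - (\<Sum>i\<le>j. level_bump' i x)) h)"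
        by (simp add: j lessThan_Suc_atMost blinfun.bilinear_simps blinfun.sum_left norm_minus_commute)
      also have "\<dots> \<le> norm (bump_sum' x - (\<Sum>i\<le>j. level_bump' i x)) * norm h"
        by (rule norm_blinfun)
      also have "\<dots> \<le> (9 * H * radius j) * norm h"
        unfolding bump_sum'_def using H_nonneg norm_level_bump'_le
        by (intro mult_right_mono series_tail_le) auto
      also have "\<dots> \<le> e * norm h" using N[OF j(2)] by (intro mult_right_mono) auto
      finally show ?thesis .
    qed
    then show "\<forall>\<^sub>F n in sequentially. \<forall>x\<in>UNIV. \<forall>h.
        norm ((\<Sum>i<n. level_bump' i x h) - bump_sum' x h) \<le> e * norm h"
      unfolding eventually_sequentially by blast
  qed auto
  then obtain g where g: "\<And>x. (\<lambda>n. level_bump n x) sums g x" "\<And>x. (g has_derivative bump_sum' x) (at x)"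
    by auto
  moreover have "g = bump_sum" using g(1) by (auto simp: bump_sum_def fun_eq_iff sums_iff)
  ultimately show ?thesis by simp
qed

end

section \<open>A graph with prescribed slope exactly on the Cantor set\<close>

text \<open>The cut-off decreases radially, so differentiating it contributes
\<open>- 2 * b * cutoff' (y \<bullet> y) * (y \<bullet> e)\<^sup>2\<close>, which is nonnegative: removing part of the tilt \<open>b\<close> by means of
a bump lowers the derivative in direction \<open>e\<close> by at most \<open>b\<close> itself, whatever the slope of the
cut-off. Only the other part \<open>N\<close> of the correction suffers from that slope.\<close>

lemma bump'_transversal:
  assumes "norm y \<le> 2" "norm e = 1" "norm \<nu> = 1" "0 \<le> b"
  shows "- 9 * norm N - b \<le> bump' (N - b *\<^sub>R rank_one e \<nu>) y e \<bullet> \<nu>"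
proof -
  let ?c = "cutoff (y \<bullet> y)" and ?c' = "cutoff' (y \<bullet> y)"
  have \<nu>: "\<nu> \<bullet> \<nu> = 1" "e \<bullet> e = 1" using assms by (simp_all add: dot_square_norm)
  have eq: "bump' (N - b *\<^sub>R rank_one e \<nu>) y e \<bullet> \<nu>
      = ?c * (N e \<bullet> \<nu>) - ?c * b + 2 * (?c' * (y \<bullet> e) * (N y \<bullet> \<nu>)) - 2 * b * (?c' * (y \<bullet> e)\<^sup>2)"
    by (simp add: bump'_def blinfun.bilinear_simps inner_simps \<nu> power2_eq_square
        algebra_simps inner_commute[of e y])
  have Ne: "\<bar>N e \<bullet> \<nu>\<bar> \<le> norm N"
    using order_trans[OF Cauchy_Schwarz_ineq2 mult_right_mono[OF norm_blinfun]] assms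
    by (metis mult.right_neutral norm_ge_zero)
  have Ny: "\<bar>N y \<bullet> \<nu>\<bar> \<le> 2 * norm N"
  proof -
    have "\<bar>N y \<bullet> \<nu>\<bar> \<le> norm (N y)" using Cauchy_Schwarz_ineq2[of "N y" \<nu>] assms by simp
    also have "\<dots> \<le> norm N * norm y" by (rule norm_blinfun)
    also have "\<dots> \<le> norm N * 2" using assms by (intro mult_left_mono) auto
    finally show ?thesis by simp
  qed
  have ye: "\<bar>y \<bullet> e\<bar> \<le> 2" using Cauchy_Schwarz_ineq2[of y e] assms by simp
  have "\<bar>?c * (N e \<bullet> \<nu>)\<bar> \<le> 1 * norm N"
    unfolding abs_mult using Ne cutoff_nonneg[of "y \<bullet> y"] cutoff_le_1[of "y \<bullet> y"]
    by (intro mult_mono) auto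
  moreover have "\<bar>?c' * (y \<bullet> e) * (N y \<bullet> \<nu>)\<bar> \<le> 1 * 2 * (2 * norm N)"
    unfolding abs_mult using Ny ye cutoff'_nonpos[of "y \<bullet> y"] cutoff'_ge[of "y \<bullet> y"]
    by (intro mult_mono) auto
  moreover have "?c * b \<le> 1 * b"
    using cutoff_le_1 assms by (intro mult_right_mono) auto
  moreover have "b * (?c' * (y \<bullet> e)\<^sup>2) \<le> 0"
    using cutoff'_nonpos assms by (simp add: mult_nonneg_nonpos mult_nonpos_nonneg)
  ultimately show ?thesis unfolding eq by linarith
qed

text \<open>\<open>M x y\<close> is the slope that the graph of a function has to have at the point \<open>(x, y)\<close> in order to be tangent
to the distribution. The vectors \<open>e\<close> and \<open>\<nu>\<close> single out one scalar entry of the derivative, and \<open>B\<close> is the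
strength of the tilt that keeps this entry above its prescribed value off the Cantor set. The lower bound on
\<open>B\<close> makes the tilt win over all errors caused by the variation of \<open>M\<close>; as it depends on \<open>L\<close> and \<open>r\<close> only,
the starting radius \<open>\<epsilon>\<close> can be chosen afterwards so small that the tilt is at most \<open>1\<close>.\<close>

locale tangency_graph = cell_system D r \<epsilon> for D :: "'a::euclidean_space set" and r \<epsilon> +
  fixes M :: "'a \<Rightarrow> 'b::euclidean_space \<Rightarrow> 'a \<Rightarrow>\<^sub>L 'b" and L B :: real and e :: 'a and \<nu> :: 'b
  assumes norm_M_le: "norm (M x y) \<le> 1"
    and M_lipschitz: "norm (M x y - M x' y') \<le> L * (norm (x - x') + norm (y - y'))"
    and L_nonneg: "0 \<le> L"
    and norm_e: "norm e = 1" and norm_\<nu>: "norm \<nu> = 1"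
    and B_pos: "0 < B" and B_small: "B * \<epsilon> \<le> 1" and B_large: "38 * L < B * r"
begin

text \<open>On the cell of \<open>w\<close> the graph follows the affine map with value \<open>height w\<close> at the centre and the tilted
slope \<open>slope w\<close> there. The affine map of a child agrees with that of its parent at the centre of the child,
so their difference is the linear map \<open>jump\<close> applied to \<open>x - centre\<close>, which a bump can switch on.
The root has no parent, and its jump is the whole slope.\<close>

primrec height :: "'a list \<Rightarrow> 'b" where
  "height [] = 0"
| "height (a # w) = height w
     + (M (centre w) (height w) + (B * radius (length w)) *\<^sub>R rank_one e \<nu>) (radius (length w) *\<^sub>R a)"

definition slope :: "'a list \<Rightarrow> 'a \<Rightarrow>\<^sub>L 'b" where
  "slope w = M (centre w) (height w) + (B * radius (length w)) *\<^sub>R rank_one e \<nu>"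

primrec jump :: "'a list \<Rightarrow> 'a \<Rightarrow>\<^sub>L 'b" where
  "jump [] = slope []"
| "jump (a # w) = slope (a # w) - slope w"

lemma height_Cons: "height (a # w) = height w + slope w (radius (length w) *\<^sub>R a)"
  by (simp add: slope_def)

lemma norm_tilt_le: "norm ((B * radius j) *\<^sub>R rank_one e \<nu>) \<le> B * radius j"
  using norm_rank_one_le[of e \<nu>] norm_e norm_\<nu> B_pos radius_pos[of j]
  by (simp add: mult_left_le)

lemma norm_slope_le: "norm (slope w) \<le> 2"
proof -
  have "B * radius (length w) \<le> B * \<epsilon>"
    using B_pos radius_le by (intro mult_left_mono) auto
  then show ?thesis
    unfolding slope_def
    using norm_triangle_ineq[of "M (centre w) (height w)" "(B * radius (length w)) *\<^sub>R rank_one e \<nu>"]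
      norm_M_le[of "centre w" "height w"] norm_tilt_le[of "length w"] B_small by linarith
qed

lemma norm_jump_le_4: "norm (jump w) \<le> 4"
proof (cases w)
  case Nil
  then show ?thesis using norm_slope_le[of "[]"] by simp
next
  case (Cons a u)
  then show ?thesis
    using norm_triangle_ineq4[of "slope (a # u)" "slope u"] norm_slope_le[of "a # u"]
      norm_slope_le[of u] by simp
qed

lemma norm_M_diff_parent_le:
  assumes "a \<in> D" "w \<in> words j"
  shows "norm (M (centre (a # w)) (height (a # w)) - M (centre w) (height w)) \<le> 3 * L * radius j"
proof -
  have a: "norm (radius j *\<^sub>R a) \<le> radius j"
    using D_norm_le_1[OF assms(1)] radius_pos[of j] by (simp add: mult_left_le)
  have "norm (slope w (radius j *\<^sub>R a)) \<le> 2 * radius j"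
    using order_trans[OF norm_blinfun mult_mono[OF norm_slope_le a]] by simp
  then have "norm (centre (a # w) - centre w) + norm (height (a # w) - height w) \<le> 3 * radius j"
    using a assms by (simp add: height_Cons length_words del: height.simps(2))
  then have "L * (norm (centre (a # w) - centre w) + norm (height (a # w) - height w)) \<le> L * (3 * radius j)"
    using L_nonneg by (rule mult_left_mono)
  with M_lipschitz[of "centre (a # w)" "height (a # w)" "centre w" "height w"]
  show ?thesis by linarith
qed

lemma jump_Cons:
  assumes "w \<in> words j"
  shows "jump (a # w) = (M (centre (a # w)) (height (a # w)) - M (centre w) (height w))
    - (B * radius j * (1 - r)) *\<^sub>R rank_one e \<nu>"
  using assms by (simp add: slope_def length_words radius_Suc algebra_simps del: height.simps centre.simps)

text \<open>The term \<open>2 / \<epsilon>\<close> covers the root, whose jump need not be small.\<close>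

definition jump_bound :: real where
  "jump_bound = (3 * L + B) / r + 2 / \<epsilon>"

lemma norm_jump_le:
  assumes "w \<in> words j"
  shows "norm (jump w) \<le> jump_bound * radius j"
proof (cases j)
  case 0
  then have "norm (jump w) \<le> 2 / \<epsilon> * radius j"
    using norm_slope_le[of "[]"] \<epsilon>_pos assms by simp
  also have "\<dots> \<le> jump_bound * radius j"
    unfolding jump_bound_def using L_nonneg B_pos r_pos radius_pos[of j] by (intro mult_right_mono) auto
  finally show ?thesis .
next
  case (Suc i)
  then obtain a u where w: "w = a # u" "a \<in> D" "u \<in> words i"
    using assms words_Suc_cases by blast
  have "norm (jump w) \<le> 3 * L * radius i + norm ((B * radius i * (1 - r)) *\<^sub>R rank_one e \<nu>)"
    unfolding w(1) jump_Cons[OF w(3)]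
    using norm_M_diff_parent_le[OF w(2,3)] norm_triangle_ineq4 by (meson add_right_mono order_trans)
  also have "norm ((B * radius i * (1 - r)) *\<^sub>R rank_one e \<nu>) = (1 - r) * norm ((B * radius i) *\<^sub>R rank_one e \<nu>)"
    using r_le r_pos by (simp add: abs_mult)
  also have "\<dots> \<le> 1 * (B * radius i)"
    using r_le r_pos norm_tilt_le by (intro mult_mono) auto
  also have "3 * L * radius i + 1 * (B * radius i) = (3 * L + B) / r * radius j"
    using r_pos by (simp add: Suc radius_Suc field_simps)
  also have "\<dots> \<le> jump_bound * radius j"
    unfolding jump_bound_def using \<epsilon>_pos radius_pos[of j] by (intro mult_right_mono) auto
  finally show ?thesis by simp
qed

sublocale bump_series D r \<epsilon> jump jump_bound
  by unfold_locales (rule norm_jump_le)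

lemma norm_level_bump_le_8: "norm (level_bump j x) \<le> 8 * radius j"
  using norm_level_bump_le(1)[of j 4 x] norm_jump_le_4 by simp

text \<open>On a cell all bumps of the word and its ancestors are fully switched on, and the jumps telescope.\<close>

lemma partial_sum_eq_affine:
  assumes "w \<in> words j" "norm (x - centre w) \<le> radius j"
  shows "(\<Sum>i\<le>j. level_bump i x) = height w + slope w (x - centre w)"
    and "(\<Sum>i\<le>j. level_bump' i x) = slope w"
proof -
  have "(\<Sum>i\<le>j. level_bump i x) = height w + slope w (x - centre w) \<and> (\<Sum>i\<le>j. level_bump' i x) = slope w"
    using assms
  proof (induction j arbitrary: w)
    case 0
    then show ?case
      using level_bump_eq_word_bump[of "[]" 0 x] word_bump_inner[of "[]" 0 x] \<epsilon>_pos by simp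
  next
    case (Suc j)
    obtain a u where w: "w = a # u" "a \<in> D" "u \<in> words j"
      using Suc.prems words_Suc_cases by blast
    have "norm (x - centre u) \<le> radius j"
      using cell_nested[OF w(2,3)] Suc.prems w(1) radius_pos[of "Suc j"] by auto
    then have IH: "(\<Sum>i\<le>j. level_bump i x) = height u + slope u (x - centre u)"
      "(\<Sum>i\<le>j. level_bump' i x) = slope u"
      using Suc.IH[OF w(3)] by auto
    have top: "level_bump (Suc j) x = jump w (x - centre w)" "level_bump' (Suc j) x = jump w"
      using level_bump_eq_word_bump[OF Suc.prems(1)] word_bump_inner[OF Suc.prems]
        Suc.prems(2) radius_pos[of "Suc j"] by auto
    have "x - centre u = (x - centre w) + radius (length u) *\<^sub>R a" using w(1) by simp
    then show ?case
      unfolding sum.atMost_Suc IH top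
      by (simp add: w(1) height_Cons blinfun.bilinear_simps algebra_simps del: height.simps(2))
  qed
  then show "(\<Sum>i\<le>j. level_bump i x) = height w + slope w (x - centre w)"
    "(\<Sum>i\<le>j. level_bump' i x) = slope w" by auto
qed

lemma bump_sum_near_height:
  assumes "w \<in> words j" "norm (x - centre w) \<le> radius j"
  shows "norm (bump_sum x - height w) \<le> 10 * radius j"
proof -
  have "norm (bump_sum x - (height w + slope w (x - centre w))) \<le> 8 * radius j"
    using series_tail_le[of "\<lambda>i. level_bump i x" 8 j] norm_level_bump_le_8
    unfolding partial_sum_eq_affine(1)[OF assms] bump_sum_def by simp
  moreover have "norm (slope w (x - centre w)) \<le> 2 * radius j"
    using order_trans[OF norm_blinfun mult_mono[OF norm_slope_le assms(2)]] by simp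
  ultimately show ?thesis
    using norm_triangle_ineq[of "bump_sum x - (height w + slope w (x - centre w))" "slope w (x - centre w)"]
    by simp
qed

lemma bump_sum'_near_slope:
  assumes "w \<in> words j" "norm (x - centre w) \<le> radius j"
  shows "norm (bump_sum' x - slope w) \<le> 9 * jump_bound * radius j"
  using series_tail_le[of "\<lambda>i. level_bump' i x" "9 * jump_bound" j] norm_level_bump'_le H_nonneg
  unfolding partial_sum_eq_affine(2)[OF assms] bump_sum'_def by simp

lemma norm_bump_sum_le: "norm x \<le> \<epsilon> \<Longrightarrow> norm (bump_sum x) \<le> 10 * \<epsilon>"
  using bump_sum_near_height[of "[]" 0 x] by simp

lemma M_near_cell:
  assumes "w \<in> words j" "norm (x - centre w) \<le> radius j"
  shows "norm (M x (bump_sum x) - M (centre w) (height w)) \<le> 11 * L * radius j"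
proof -
  have "norm (x - centre w) + norm (bump_sum x - height w) \<le> 11 * radius j"
    using bump_sum_near_height[OF assms] assms(2) by simp
  from mult_left_mono[OF this L_nonneg] M_lipschitz[of x "bump_sum x" "centre w" "height w"]
  show ?thesis by (simp add: mult_ac)
qed

text \<open>Around a point of the Cantor set there are arbitrarily small cells, on which the derivative,
the slope of the cell and the prescribed slope differ by a multiple of the radius only.\<close>

lemma bump_sum'_on_cantor:
  assumes "x \<in> cantor"
  shows "bump_sum' x = M x (bump_sum x)"
proof -
  let ?K = "9 * jump_bound + B + 11 * L"
  have le: "norm (bump_sum' x - M x (bump_sum x)) \<le> ?K * radius j" for j
  proof -
    obtain w where w: "w \<in> words j" "norm (x - centre w) \<le> radius j"
      using assms unfolding cantor_def by blast
    have "bump_sum' x - M x (bump_sum x) = (bump_sum' x - slope w)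
        + (B * radius j) *\<^sub>R rank_one e \<nu> - (M x (bump_sum x) - M (centre w) (height w))"
      using w(1) by (simp add: slope_def length_words)
    also have "norm \<dots> \<le> norm (bump_sum' x - slope w) + norm ((B * radius j) *\<^sub>R rank_one e \<nu>)
        + norm (M x (bump_sum x) - M (centre w) (height w))"
      by (rule order_trans[OF norm_triangle_ineq4 add_right_mono[OF norm_triangle_ineq]])
    also have "\<dots> \<le> 9 * jump_bound * radius j + B * radius j + 11 * L * radius j"
      using bump_sum'_near_slope[OF w] norm_tilt_le[of j] M_near_cell[OF w] by linarith
    finally show ?thesis by (simp add: algebra_simps)
  qed
  have "(\<lambda>j. ?K * radius j) \<longlonglongrightarrow> 0"
    by (auto intro!: tendsto_eq_intros radius_tendsto_0)
  then have "norm (bump_sum' x - M x (bump_sum x)) \<le> 0"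
    by (rule LIMSEQ_le_const) (use le in blast)
  then show ?thesis by simp
qed

lemma deepest_cell:
  assumes "norm x \<le> \<epsilon>" "x \<notin> cantor"
  obtains j w where "w \<in> words j" "norm (x - centre w) \<le> radius j"
    "\<And>u. u \<in> words (Suc j) \<Longrightarrow> radius (Suc j) < norm (x - centre u)"
proof -
  let ?P = "\<lambda>j. \<exists>w\<in>words j. norm (x - centre w) \<le> radius j"
  have ex: "\<exists>j. \<not> ?P j" using assms(2) by (auto simp: cantor_def)
  define n where "n = (LEAST j. \<not> ?P j)"
  have n: "\<not> ?P n" unfolding n_def using ex by (rule LeastI_ex)
  have "?P 0" using assms(1) by simp
  with n have "n \<noteq> 0" by metis
  then obtain j where j: "n = Suc j" by (cases n) auto
  have "?P j" using not_less_Least[of j "\<lambda>j. \<not> ?P j"] j n_def by auto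
  then show thesis using that n j by (auto simp: not_le)
qed

text \<open>Below the deepest cell containing \<open>x\<close>, of level \<open>j\<close>, at most one further bump is active. The cell itself has
tilt \<open>B * radius j\<close>, and the bump takes away at most the fraction \<open>1 - r\<close> of it. The variation of \<open>M\<close> costs
\<open>27 * L * radius j\<close> within the bump and \<open>11 * L * radius j\<close> between the cell and \<open>x\<close>, which is where the
number \<open>38\<close> in the assumption on \<open>B\<close> comes from.\<close>

lemma bump_sum'_off_cantor:
  assumes "norm x \<le> \<epsilon>" "x \<notin> cantor"
  shows "M x (bump_sum x) e \<bullet> \<nu> < bump_sum' x e \<bullet> \<nu>"
proof -
  obtain j w where w: "w \<in> words j" "norm (x - centre w) \<le> radius j"
    and deepest: "\<And>u. u \<in> words (Suc j) \<Longrightarrow> radius (Suc j) < norm (x - centre u)"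
    using deepest_cell[OF assms] by blast
  have "level_bump' i x = 0" if "i > Suc j" for i
  proof (rule level_bump_eq_0)
    show "2 * radius i \<le> norm (x - centre u)" if "u \<in> words i" for u
      using ancestor_cell[OF \<open>i > Suc j\<close> that, of x] deepest by force
  qed
  then have "bump_sum' x = (\<Sum>i\<le>Suc j. level_bump' i x)"
    unfolding bump_sum'_def by (intro suminf_finite) auto
  then have sum: "bump_sum' x = slope w + level_bump' (Suc j) x"
    using partial_sum_eq_affine(2)[OF w] by simp
  have slope: "slope w e \<bullet> \<nu> = M (centre w) (height w) e \<bullet> \<nu> + B * radius j"
    using w norm_e norm_\<nu>
    by (simp add: slope_def length_words blinfun.bilinear_simps inner_simps dot_square_norm)
  have top: "- 27 * L * radius j - B * radius j * (1 - r) \<le> level_bump' (Suc j) x e \<bullet> \<nu>"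
  proof (cases "\<exists>u\<in>words (Suc j). norm (x - centre u) < 2 * radius (Suc j)")
    case True
    then obtain u where u: "u \<in> words (Suc j)" "norm (x - centre u) < 2 * radius (Suc j)" by blast
    obtain a w' where w': "u = a # w'" "a \<in> D" "w' \<in> words j"
      using u words_Suc_cases by blast
    have "norm (x - centre w') \<le> radius j" using cell_nested[OF w'(2,3)] u w'(1) by simp
    then have "w' = w" using same_cell[OF w'(3) w(1), of x x] w radius_pos[of j] by simp
    define N where "N = M (centre u) (height u) - M (centre w) (height w)"
    define y where "y = (x - centre u) /\<^sub>R radius (Suc j)"
    have jump: "jump u = N - (B * radius j * (1 - r)) *\<^sub>R rank_one e \<nu>"
      unfolding N_def w'(1) \<open>w' = w\<close> using w(1) by (rule jump_Cons)
    have "norm y = norm (x - centre u) / radius (Suc j)"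
      using radius_pos[of "Suc j"] by (simp add: y_def divide_inverse_commute)
    then have y: "norm y \<le> 2"
      using u(2) radius_pos[of "Suc j"] by (simp add: divide_le_eq)
    have "level_bump' (Suc j) x = bump' (jump u) y"
      using level_bump_eq_word_bump(2)[OF u(1)] u radius_pos[of "Suc j"]
      by (simp add: word_bump'_def length_words y_def)
    moreover have "norm N \<le> 3 * L * radius j"
      unfolding N_def w'(1) \<open>w' = w\<close> using norm_M_diff_parent_le w' \<open>w' = w\<close> by blast
    moreover have "0 \<le> B * radius j * (1 - r)" using B_pos radius_pos[of j] r_le by simp
    ultimately show ?thesis
      using bump'_transversal[OF y norm_e norm_\<nu>, of "B * radius j * (1 - r)" N] jump by simp
  next
    case False
    then have "level_bump' (Suc j) x = 0" by (intro level_bump_eq_0) auto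
    moreover have "0 \<le> L * radius j" "0 \<le> B * radius j * (1 - r)"
      using L_nonneg B_pos radius_pos[of j] r_le by simp_all
    ultimately show ?thesis by simp
  qed
  have M: "M x (bump_sum x) e \<bullet> \<nu> - M (centre w) (height w) e \<bullet> \<nu> \<le> 11 * L * radius j"
  proof -
    have "M x (bump_sum x) e \<bullet> \<nu> - M (centre w) (height w) e \<bullet> \<nu>
        = (M x (bump_sum x) - M (centre w) (height w)) e \<bullet> \<nu>"
      by (simp add: blinfun.bilinear_simps inner_simps)
    also have "\<dots> \<le> norm ((M x (bump_sum x) - M (centre w) (height w)) e) * norm \<nu>"
      by (rule norm_cauchy_schwarz)
    also have "\<dots> \<le> norm (M x (bump_sum x) - M (centre w) (height w))"
      using norm_blinfun[of "M x (bump_sum x) - M (centre w) (height w)" e] norm_e norm_\<nu> by simp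
    also have "\<dots> \<le> 11 * L * radius j" by (rule M_near_cell[OF w])
    finally show ?thesis .
  qed
  have "38 * L * radius j < B * r * radius j"
    using B_large radius_pos[of j] by (intro mult_strict_right_mono) auto
  then show ?thesis
    using M slope top unfolding sum by (simp add: blinfun.bilinear_simps inner_simps algebra_simps)
qed

text \<open>This keeps the values of the function in the orthogonal complement of the plane over which it is a graph.\<close>

lemma bump_sum_orthogonal:
  assumes "\<nu> \<bullet> z = 0" "\<And>x y h. M x y h \<bullet> z = 0"
  shows "bump_sum x \<bullet> z = 0"
proof -
  have slope: "slope w h \<bullet> z = 0" for w h
    using assms by (simp add: slope_def blinfun.bilinear_simps inner_simps)
  have "jump w h \<bullet> z = 0" for w h
    by (cases w) (simp_all add: slope blinfun.bilinear_simps inner_simps)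
  then have "level_bump j x \<bullet> z = 0" for j
    by (simp add: level_bump_def word_bump_def bump_def inner_sum_left)
  moreover have "bump_sum x \<bullet> z = (\<Sum>j. level_bump j x \<bullet> z)"
    unfolding bump_sum_def
    by (rule bounded_linear.suminf[OF bounded_linear_inner_left summable_level_bump])
  ultimately show ?thesis by simp
qed

end

section \<open>The Hausdorff dimension of the Cantor set and its images\<close>

lemma hausdorff_premeasure_le_finite_sum:
  fixes A :: "'a::metric_space set"
  assumes "finite I" "A \<subseteq> (\<Union>i\<in>I. Q i)" "0 \<le> \<delta>"
    and Q: "\<And>i. i \<in> I \<Longrightarrow> bounded (Q i) \<and> diameter (Q i) \<le> \<delta>"
  shows "hausdorff_premeasure s \<delta> A \<le> (\<Sum>i\<in>I. hausdorff_gauge s (Q i))"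
proof -
  obtain h where h: "bij_betw h {0..<card I} I"
    using ex_bij_betw_nat_finite[OF \<open>finite I\<close>] by blast
  define C where "C n = (if n < card I then Q (h n) else {})" for n
  have "h n \<in> I" if "n < card I" for n using h that by (auto simp: bij_betw_def)
  then have C: "bounded (C n) \<and> diameter (C n) \<le> \<delta>" for n
    using Q \<open>0 \<le> \<delta>\<close> by (simp add: C_def)
  have "(\<Union>i\<in>I. Q i) = (\<Union>i\<in>h ` {0..<card I}. Q i)" using h by (simp add: bij_betw_def)
  also have "\<dots> \<subseteq> (\<Union>n. C n)" by (auto simp: C_def split: if_splits)
  finally have "A \<subseteq> (\<Union>n. C n)" by (rule order_trans[OF assms(2)])
  with C have "C \<in> {C. A \<subseteq> (\<Union>i. C i) \<and> (\<forall>i. bounded (C i) \<and> diameter (C i) \<le> \<delta>)}" by simp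
  then have "hausdorff_premeasure s \<delta> A \<le> (\<Sum>n. hausdorff_gauge s (C n))"
    unfolding hausdorff_premeasure_def by (rule INF_lower)
  also have "\<dots> = (\<Sum>n\<in>{0..<card I}. hausdorff_gauge s (C n))"
    by (rule suminf_finite) (auto simp: C_def hausdorff_gauge_def)
  also have "\<dots> = (\<Sum>n\<in>{0..<card I}. hausdorff_gauge s (Q (h n)))"
    by (intro sum.cong) (auto simp: C_def)
  also have "\<dots> = (\<Sum>i\<in>I. hausdorff_gauge s (Q i))"
    by (rule sum.reindex_bij_betw[OF h])
  finally show ?thesis .
qed

lemma hausdorff_dim_eqI:
  assumes "0 \<le> d"
    and above: "\<And>s. d < s \<Longrightarrow> hausdorff_measure s A = 0"
    and below: "\<And>s. 0 \<le> s \<Longrightarrow> s < d \<Longrightarrow> hausdorff_measure s A \<noteq> 0"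
  shows "hausdorff_dim A = ereal d"
proof (rule antisym)
  show "ereal d \<le> hausdorff_dim A"
    unfolding hausdorff_dim_def using below by (intro INF_greatest) (auto simp: not_less[symmetric])
  show "hausdorff_dim A \<le> ereal d"
  proof (rule ereal_le_epsilon2)
    fix e :: real assume "0 < e"
    then show "hausdorff_dim A \<le> ereal d + ereal e"
      unfolding hausdorff_dim_def using above[of "d + e"] assms(1)
      by (intro INF_lower2[of "d + e"]) auto
  qed
qed

lemma interval_of_floor_eq:
  assumes "0 < N"
  shows "{t. \<lfloor>N * t\<rfloor> = a} = {real_of_int a / N..<(real_of_int a + 1) / N}"
  using assms by (auto simp: floor_eq_iff field_simps)

lemma power_powr_commute: "0 < x \<Longrightarrow> (x ^ j) powr s = (x powr s) ^ j" for x s :: real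
  by (simp add: powr_def ln_realpow exp_of_nat_mult[symmetric] mult.left_commute)

context cell_system
begin

lemma centre_in_subspace:
  assumes "subspace E" "D \<subseteq> E" "w \<in> words j"
  shows "centre w \<in> E"
  using assms(3)
proof (induction w arbitrary: j)
  case (Cons a w)
  then show ?case
    using assms(1,2) by (auto simp: Cons_in_words_iff intro!: subspace_add subspace_mul)
qed (simp add: assms subspace_0)

text \<open>Level \<open>j\<close> consists of \<open>card D ^ j\<close> cells of size comparable to \<open>r ^ j\<close>, and \<open>card D * r powr s < 1\<close>.\<close>

lemma hausdorff_measure_image_cantor_eq_0:
  fixes g :: "'a \<Rightarrow> 'c::euclidean_space"
  assumes dim: "real (card D) * r powr d = 1" and "0 \<le> d" "d < s" and "0 < C"
    and upper: "\<And>j w x. w \<in> words j \<Longrightarrow> x \<in> cantor \<inter> E \<Longrightarrow> norm (x - centre w) \<le> radius j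
      \<Longrightarrow> dist (p w) (g x) \<le> C * radius j"
  shows "hausdorff_measure s (g ` (cantor \<inter> E)) = 0"
proof -
  let ?A = "g ` (cantor \<inter> E)" and ?N = "card D"
  have cover: "?A \<subseteq> (\<Union>w\<in>words j. cball (p w) (C * radius j))" for j
  proof
    fix z assume "z \<in> ?A"
    then obtain x where x: "z = g x" "x \<in> cantor \<inter> E" by blast
    then obtain w where w: "w \<in> words j" "norm (x - centre w) \<le> radius j"
      unfolding cantor_def by blast
    have "z \<in> cball (p w) (C * radius j)" using upper[OF w(1) x(2) w(2)] x(1) by simp
    then show "z \<in> (\<Union>w\<in>words j. cball (p w) (C * radius j))" using w(1) by blast
  qed
  define q where "q = real ?N * r powr s"
  have "q = r powr (s - d)"
    using dim r_pos by (simp add: q_def powr_diff field_simps)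
  then have q: "0 \<le> q" "q < 1"
    using r_pos r_le \<open>d < s\<close> powr_less_mono2[of "s - d" r 1] by simp_all
  have le: "hausdorff_premeasure s \<delta> ?A \<le> ennreal ((2 * C * \<epsilon>) powr s * q ^ j)"
    if "2 * C * radius j \<le> \<delta>" for \<delta> j
  proof -
    have pos: "0 < 2 * C * radius j" using \<open>0 < C\<close> radius_pos[of j] by simp
    have "hausdorff_premeasure s \<delta> ?A
        \<le> (\<Sum>w\<in>words j. hausdorff_gauge s (cball (p w) (C * radius j)))"
      using that pos by (intro hausdorff_premeasure_le_finite_sum finite_words cover) auto
    also have "\<dots> = (\<Sum>w\<in>words j. ennreal ((2 * C * radius j) powr s))"
      using pos assms by (intro sum.cong) (auto simp: hausdorff_gauge_def mult.assoc)
    also have "\<dots> = ennreal (real (?N ^ j) * (2 * C * radius j) powr s)"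
      by (simp add: card_words ennreal_mult ennreal_of_nat_eq_real_of_nat del: of_nat_power)
    also have "real (?N ^ j) * (2 * C * radius j) powr s = (2 * C * \<epsilon>) powr s * q ^ j"
    proof -
      have "(2 * C * radius j) powr s = (2 * C * \<epsilon>) powr s * (r ^ j) powr s"
        using powr_mult[of "2 * C * \<epsilon>" "r ^ j" s] \<open>0 < C\<close> \<epsilon>_pos r_pos
        by (simp add: radius_def mult.assoc)
      also have "(r ^ j) powr s = (r powr s) ^ j"
        using r_pos by (rule power_powr_commute)
      finally show ?thesis by (simp add: q_def power_mult_distrib)
    qed
    finally show ?thesis .
  qed
  have lim: "(\<lambda>j. (2 * C * \<epsilon>) powr s * q ^ j) \<longlonglongrightarrow> 0"
    using q by (auto intro!: tendsto_eq_intros LIMSEQ_realpow_zero)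
  have "hausdorff_premeasure s \<delta> ?A = 0" if "0 < \<delta>" for \<delta>
  proof -
    have "(\<lambda>j. 2 * C * radius j) \<longlonglongrightarrow> 0"
      by (auto intro!: tendsto_eq_intros radius_tendsto_0)
    then have "\<forall>\<^sub>F j in sequentially. 2 * C * radius j < \<delta>"
      using that by (rule order_tendstoD)
    then have "\<forall>\<^sub>F j in sequentially. hausdorff_premeasure s \<delta> ?A \<le> ennreal ((2 * C * \<epsilon>) powr s * q ^ j)"
      by eventually_elim (use le in auto)
    moreover have "(\<lambda>j. ennreal ((2 * C * \<epsilon>) powr s * q ^ j)) \<longlonglongrightarrow> 0"
      using tendsto_ennrealI[OF lim] by simp
    ultimately have "hausdorff_premeasure s \<delta> ?A \<le> 0"
      by (intro tendsto_lowerbound) auto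
    then show ?thesis by simp
  qed
  then show ?thesis unfolding hausdorff_measure_def by simp
qed

lemma cantor_point_of_branch:
  assumes "subspace E" "D \<subseteq> E"
    and words: "\<And>j. u j \<in> words j" and branch: "\<And>j. \<exists>a\<in>D. u (Suc j) = a # u j"
  shows "\<exists>x\<in>E. \<forall>j. norm (x - centre (u j)) \<le> radius j"
proof -
  define F where "F j = cball (centre (u j)) (radius j) \<inter> E" for j
  have "F (Suc j) \<subseteq> F j" for j
  proof -
    obtain a where "a \<in> D" "u (Suc j) = a # u j" using branch by blast
    then show ?thesis
      using cell_nested[of a "u j" j] words radius_pos[of "Suc j"]
      by (fastforce simp: F_def dist_norm norm_minus_commute simp del: centre.simps)
  qed
  then have "F n \<subseteq> F m" if "m \<le> n" for m n using that by (rule lift_Suc_antimono_le)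
  moreover have "compact (F j)" for j
    unfolding F_def using assms(1) by (intro compact_Int_closed closed_subspace) auto
  moreover have "F j \<noteq> {}" for j
  proof -
    have "centre (u j) \<in> F j"
      using centre_in_subspace[OF assms(1,2) words] radius_nonneg[of j] by (simp add: F_def)
    then show ?thesis by blast
  qed
  ultimately have "\<Inter>(range F) \<noteq> {}" by (intro compact_nest)
  then obtain x where "\<And>j. x \<in> F j" by blast
  then show ?thesis by (intro bexI[of _ x]) (auto simp: F_def dist_norm norm_minus_commute)
qed

text \<open>Expansion in base \<open>N = card D\<close> assigns to each \<open>t\<close> in \<open>[0,1)\<close> a point of the Cantor set. A set of diameter
below \<open>radius j\<close> meets the image of one \<open>N\<close>-adic interval of length \<open>1 / N ^ j = (r ^ j) powr d\<close> only.
Hence the diameters of a covering, raised to the power \<open>d\<close>, dominate the lengths of intervals that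
cover \<open>[0,1)\<close>, and countable subadditivity of Lebesgue measure bounds the covering sum from below.\<close>

lemma hausdorff_measure_image_cantor_neq_0:
  fixes g :: "'a \<Rightarrow> 'c::euclidean_space"
  assumes dim: "real (card D) * r powr d = 1" and "0 \<le> s" "s < d"
    and E: "subspace E" "D \<subseteq> E"
    and lower: "\<And>x y. x \<in> cantor \<inter> E \<Longrightarrow> y \<in> cantor \<inter> E \<Longrightarrow> norm (x - y) \<le> dist (g x) (g y)"
  shows "hausdorff_measure s (g ` (cantor \<inter> E)) \<noteq> 0"
proof -
  let ?A = "g ` (cantor \<inter> E)"
  define N where "N = card D"
  have powr_pos: "0 < r powr d" using r_pos by simp
  have N: "1 < real N"
  proof -
    have "r powr d < 1" using powr_less_mono2[of d r 1] r_pos r_le assms by simp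
    moreover have "real N = 1 / r powr d" using dim powr_pos by (simp add: N_def field_simps)
    ultimately show ?thesis using powr_pos by simp
  qed
  obtain b where b: "bij_betw b {..<N} D"
    using ex_bij_betw_nat_finite[OF finite_D] by (auto simp: N_def atLeast0LessThan)
  define code :: "real \<Rightarrow> nat \<Rightarrow> 'a list" where
    "code t = rec_nat [] (\<lambda>j w. b (nat (\<lfloor>real N ^ Suc j * t\<rfloor> mod int N)) # w)" for t
  have code_0: "code t 0 = []"
    and code_Suc: "code t (Suc j) = b (nat (\<lfloor>real N ^ Suc j * t\<rfloor> mod int N)) # code t j" for t j
    by (simp_all add: code_def)
  have digit: "nat (k mod int N) \<in> {..<N}" for k
    using N by (simp add: nat_less_iff)
  then have b_digit: "b (nat (k mod int N)) \<in> D" for k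
    using b by (auto simp: bij_betw_def)
  have code_words: "code t j \<in> words j" for t j
    by (induction j) (auto simp: code_0 code_Suc Cons_in_words_iff b_digit)
  have floor_eq: "\<lfloor>real N ^ j * t\<rfloor> = \<lfloor>real N ^ j * t'\<rfloor>"
    if "code t j = code t' j" "t \<in> {0..<1}" "t' \<in> {0..<1}" for t t' j
    using that(1)
  proof (induction j)
    case 0
    have "\<lfloor>t\<rfloor> = 0" "\<lfloor>t'\<rfloor> = 0" using that by (auto simp: floor_eq_iff)
    then show ?case by simp
  next
    case (Suc j)
    have div: "\<lfloor>real N ^ Suc j * t\<rfloor> div int N = \<lfloor>real N ^ j * t\<rfloor>" for t
      using floor_divide_real_eq_div[of "int N" "real N ^ Suc j * t"] N by simp
    have "nat (\<lfloor>real N ^ Suc j * t\<rfloor> mod int N) = nat (\<lfloor>real N ^ Suc j * t'\<rfloor> mod int N)"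
      using Suc.prems b digit unfolding code_Suc bij_betw_def by (metis inj_onD list.inject)
    then have "\<lfloor>real N ^ Suc j * t\<rfloor> mod int N = \<lfloor>real N ^ Suc j * t'\<rfloor> mod int N"
      using N by (simp add: eq_nat_nat_iff)
    moreover have "\<lfloor>real N ^ Suc j * t\<rfloor> div int N = \<lfloor>real N ^ Suc j * t'\<rfloor> div int N"
      using Suc unfolding div code_Suc by simp
    ultimately show ?case by (metis div_mult_mod_eq)
  qed
  have "\<exists>x\<in>E. \<forall>j. norm (x - centre (code t j)) \<le> radius j" for t
    using code_words b_digit by (intro cantor_point_of_branch[OF E]) (auto simp: code_Suc)
  then obtain point where point: "\<And>t. point t \<in> E"
    "\<And>t j. norm (point t - centre (code t j)) \<le> radius j" by metis
  have point_cantor: "point t \<in> cantor \<inter> E" for t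
    using point code_words unfolding cantor_def by blast
  have close: "\<lfloor>real N ^ j * t\<rfloor> = \<lfloor>real N ^ j * t'\<rfloor>"
    if "dist (g (point t)) (g (point t')) < radius j" "t \<in> {0..<1}" "t' \<in> {0..<1}" for t t' j
  proof -
    have "norm (point t - point t') < radius j"
      using lower[OF point_cantor point_cantor] that(1) by (rule le_less_trans)
    moreover have "norm (point t - centre (code t j)) \<le> 2 * radius j" for t
      using point(2)[of t j] radius_pos[of j] by simp
    ultimately have "code t j = code t' j"
      using radius_pos[of j] by (intro same_cell[of _ j _ "point t" "point t'"] code_words) auto
    then show ?thesis using that by (intro floor_eq)
  qed
  define c where "c = (\<epsilon> * r) powr (- d)"
  have c: "0 < c" using \<epsilon>_pos r_pos by (simp add: c_def)
  define \<delta> where "\<delta> = min 1 (\<epsilon> / 2)"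
  have \<delta>: "0 < \<delta>" using \<epsilon>_pos by (simp add: \<delta>_def)
  have piece: "\<exists>J\<in>sets lborel. {t\<in>{0..<1}. g (point t) \<in> C} \<subseteq> J
      \<and> emeasure lborel J \<le> ennreal c * hausdorff_gauge s C"
    if C: "bounded C" "diameter C \<le> \<delta>" for C
  proof (cases "{t\<in>{0..<1}. g (point t) \<in> C} = {}")
    case True
    then show ?thesis by (intro bexI[of _ "{}"]) auto
  next
    case False
    then obtain t0 where t0: "t0 \<in> {0..<1}" "g (point t0) \<in> C" by blast
    have near: "\<lfloor>real N ^ j * t\<rfloor> = \<lfloor>real N ^ j * t0\<rfloor>"
      if "t \<in> {0..<1}" "g (point t) \<in> C" "diameter C < radius j" for t j
    proof (rule close)
      show "dist (g (point t)) (g (point t0)) < radius j"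
        using diameter_bounded_bound[OF C(1) that(2) t0(2)] that(3) by simp
    qed (use that t0 in auto)
    have diam_nonneg: "0 \<le> diameter C" using C(1) by (rule diameter_ge_0)
    show ?thesis
    proof (cases "diameter C = 0")
      case True
      have "t = t0" if "t \<in> {0..<1}" "g (point t) \<in> C" for t
      proof (rule ccontr)
        \<comment> \<open>Two different numbers are separated by their expansions at some level.\<close>
        assume "t \<noteq> t0"
        then obtain j where j: "1 / \<bar>t - t0\<bar> < real N ^ j"
          using real_arch_pow[OF N] by blast
        have "\<lfloor>real N ^ j * t\<rfloor> = \<lfloor>real N ^ j * t0\<rfloor>"
          using near[OF that, of j] True radius_pos[of j] by simp
        then have "\<bar>real N ^ j * t - real N ^ j * t0\<bar> < 1" by linarith
        then have "real N ^ j * \<bar>t - t0\<bar> < 1"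
          by (simp add: abs_mult flip: right_diff_distrib)
        then show False using j \<open>t \<noteq> t0\<close> by (simp add: divide_less_eq)
      qed
      then have "{t\<in>{0..<1}. g (point t) \<in> C} \<subseteq> {t0}" by auto
      then show ?thesis by (intro bexI[of _ "{t0}"]) auto
    next
      case False
      then have diam: "0 < diameter C" using diam_nonneg by simp
      have "\<exists>j. radius j \<le> diameter C"
      proof -
        have "\<forall>\<^sub>F j in sequentially. radius j < diameter C"
          using radius_tendsto_0 diam by (rule order_tendstoD)
        then show ?thesis unfolding eventually_sequentially by (meson less_imp_le order_refl)
      qed
      then obtain n where n: "radius n \<le> diameter C" "\<And>i. i < n \<Longrightarrow> diameter C < radius i"
        using exists_least_iff[of "\<lambda>j. radius j \<le> diameter C"] by (auto simp: not_le)
      have "n \<noteq> 0" using n(1) C(2) \<epsilon>_pos by (intro notI) (simp add: \<delta>_def)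
      then obtain j where "n = Suc j" by (cases n) auto
      then have j: "diameter C < radius j" "radius (Suc j) \<le> diameter C" using n by auto
      \<comment> \<open>All parameters of points in \<open>C\<close> share the first \<open>j\<close> digits with \<open>t0\<close>.\<close>
      define J where "J = {t. \<lfloor>real N ^ j * t\<rfloor> = \<lfloor>real N ^ j * t0\<rfloor>}"
      have Nj: "0 < real N ^ j" using N by simp
      have J: "J = {real_of_int \<lfloor>real N ^ j * t0\<rfloor> / real N ^ j..<(real_of_int \<lfloor>real N ^ j * t0\<rfloor> + 1) / real N ^ j}"
        unfolding J_def using Nj by (rule interval_of_floor_eq)
      have "emeasure lborel J = ennreal (1 / real N ^ j)"
        unfolding J using Nj by (simp add: divide_right_mono diff_divide_distrib[symmetric])
      also have "1 / real N ^ j \<le> c * diameter C powr s"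
      proof -
        have "1 / real N = r powr d" using dim N by (simp add: N_def field_simps)
        then have "1 / real N ^ j = (r powr d) ^ j" by (metis power_one_over)
        also have "\<dots> = (r ^ j) powr d"
          using r_pos by (rule power_powr_commute[symmetric])
        also have "r ^ j = radius (Suc j) / (\<epsilon> * r)"
          using r_pos \<epsilon>_pos by (simp add: radius_def)
        also have "(radius (Suc j) / (\<epsilon> * r)) powr d \<le> (diameter C / (\<epsilon> * r)) powr d"
          using j(2) r_pos \<epsilon>_pos radius_pos[of "Suc j"] assms
          by (intro powr_mono2 divide_right_mono) auto
        also have "\<dots> = c * diameter C powr d"
          using diam r_pos \<epsilon>_pos by (simp add: c_def powr_divide powr_minus field_simps)
        also have "\<dots> \<le> c * diameter C powr s"
          using c diam C(2) assms by (intro mult_left_mono powr_mono') (auto simp: \<delta>_def)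
        finally show ?thesis .
      qed
      also have "ennreal (c * diameter C powr s) = ennreal c * hausdorff_gauge s C"
        using t0 c diam by (auto simp: hausdorff_gauge_def ennreal_mult)
      finally have "emeasure lborel J \<le> ennreal c * hausdorff_gauge s C" by (simp add: ennreal_leI)
      moreover have "J \<in> sets lborel" unfolding J by simp
      moreover have "{t\<in>{0..<1}. g (point t) \<in> C} \<subseteq> J"
        unfolding J_def using near[OF _ _ j(1)] by auto
      ultimately show ?thesis by blast
    qed
  qed
  have "ennreal (1 / c) \<le> hausdorff_premeasure s \<delta> ?A"
    unfolding hausdorff_premeasure_def
  proof (rule INF_greatest)
    fix C assume "C \<in> {C. ?A \<subseteq> (\<Union>i. C i) \<and> (\<forall>i::nat. bounded (C i) \<and> diameter (C i) \<le> \<delta>)}"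
    then have C: "?A \<subseteq> (\<Union>i. C i)" "\<And>i. bounded (C i)" "\<And>i. diameter (C i) \<le> \<delta>" by auto
    obtain J where J: "\<And>i. J i \<in> sets lborel" "\<And>i. {t\<in>{0..<1}. g (point t) \<in> C i} \<subseteq> J i"
      "\<And>i. emeasure lborel (J i) \<le> ennreal c * hausdorff_gauge s (C i)"
      using piece[OF C(2,3)] by metis
    have "{0..<1} \<subseteq> (\<Union>i. J i)"
    proof
      fix t :: real assume "t \<in> {0..<1}"
      moreover obtain i where "g (point t) \<in> C i" using C(1) point_cantor[of t] by blast
      ultimately show "t \<in> (\<Union>i. J i)" using J(2)[of i] by blast
    qed
    then have "emeasure lborel {0..<1::real} \<le> emeasure lborel (\<Union>i. J i)"
      using J(1) by (intro emeasure_mono) auto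
    also have "\<dots> \<le> (\<Sum>i. emeasure lborel (J i))"
      using J(1) by (intro emeasure_subadditive_countably) auto
    also have "\<dots> \<le> (\<Sum>i. ennreal c * hausdorff_gauge s (C i))"
      using J(3) by (intro suminf_le) auto
    also have "\<dots> = ennreal c * (\<Sum>i. hausdorff_gauge s (C i))" by simp
    finally have "1 \<le> ennreal c * (\<Sum>i. hausdorff_gauge s (C i))" by simp
    then have "ennreal (1 / c) * 1 \<le> ennreal (1 / c) * (ennreal c * (\<Sum>i. hausdorff_gauge s (C i)))"
      by (intro mult_left_mono) auto
    also have "\<dots> = (\<Sum>i. hausdorff_gauge s (C i))"
      using c by (simp add: ennreal_mult[symmetric] mult.assoc[symmetric])
    finally show "ennreal (1 / c) \<le> (\<Sum>i. hausdorff_gauge s (C i))" by simp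
  qed
  also have "\<dots> \<le> hausdorff_measure s ?A"
    unfolding hausdorff_measure_def using \<delta> by (intro SUP_upper) auto
  finally show ?thesis using c by (auto simp: ennreal_eq_0_iff)
qed

theorem hausdorff_dim_image_cantor:
  fixes g :: "'a \<Rightarrow> 'c::euclidean_space"
  assumes "real (card D) * r powr d = 1" and "0 \<le> d"
    and "subspace E" "D \<subseteq> E" and "0 < C"
    and "\<And>x y. x \<in> cantor \<inter> E \<Longrightarrow> y \<in> cantor \<inter> E \<Longrightarrow> norm (x - y) \<le> dist (g x) (g y)"
    and "\<And>j w x. w \<in> words j \<Longrightarrow> x \<in> cantor \<inter> E \<Longrightarrow> norm (x - centre w) \<le> radius j
      \<Longrightarrow> dist (p w) (g x) \<le> C * radius j"
  shows "hausdorff_dim (g ` (cantor \<inter> E)) = ereal d"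
proof (rule hausdorff_dim_eqI)
  show "hausdorff_measure s (g ` (cantor \<inter> E)) = 0" if "d < s" for s
    by (rule hausdorff_measure_image_cantor_eq_0[where C = C and p = p and d = d]) (use assms that in auto)
  show "hausdorff_measure s (g ` (cantor \<inter> E)) \<noteq> 0" if "0 \<le> s" "s < d" for s
    by (rule hausdorff_measure_image_cantor_neq_0[where d = d]) (use assms that in auto)
qed (rule assms(2))

end

section \<open>Planes, orthogonal projections and digits\<close>

locale orthonormal_frame =
  fixes B :: "'a::euclidean_space set"
  assumes finite_B: "finite B" and orthogonal_B: "pairwise orthogonal B"
    and unit_B: "b \<in> B \<Longrightarrow> norm b = 1"
begin

definition proj :: "'a \<Rightarrow>\<^sub>L 'a" where
  "proj = (\<Sum>b\<in>B. rank_one b b)"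

lemma proj_apply: "proj x = (\<Sum>b\<in>B. (x \<bullet> b) *\<^sub>R b)"
  by (simp add: proj_def blinfun.sum_left inner_commute)

lemma frame_inner: "b \<in> B \<Longrightarrow> c \<in> B \<Longrightarrow> b \<bullet> c = (if b = c then 1 else 0)"
  using orthogonal_B unit_B by (auto simp: pairwise_def orthogonal_def dot_square_norm)

lemma inner_frame_sum:
  assumes "c \<in> B"
  shows "(\<Sum>b\<in>B. f b *\<^sub>R b) \<bullet> c = f c"
proof -
  have "(\<Sum>b\<in>B. f b *\<^sub>R b) \<bullet> c = (\<Sum>b\<in>B. f b * (b \<bullet> c))"
    by (simp add: inner_sum_left)
  also have "\<dots> = (\<Sum>b\<in>B. if b = c then f c else 0)"
    using assms by (intro sum.cong) (auto simp: frame_inner)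
  also have "\<dots> = f c" using assms finite_B by simp
  finally show ?thesis .
qed

lemma proj_in_span: "proj x \<in> span B"
  unfolding proj_apply by (intro span_sum span_scale span_base)

lemma proj_residual_orthogonal: "u \<in> span B \<Longrightarrow> (x - proj x) \<bullet> u = 0"
proof (induction rule: span_induct_alt)
  case (step c b u)
  then show ?case by (simp add: inner_diff_left inner_add_right proj_apply inner_frame_sum)
qed simp

lemma proj_eqI:
  assumes "u \<in> span B" "\<And>v. v \<in> span B \<Longrightarrow> (x - u) \<bullet> v = 0"
  shows "proj x = u"
proof -
  have mem: "proj x - u \<in> span B" using proj_in_span assms(1) by (rule span_diff)
  have "(proj x - u) \<bullet> (proj x - u) = (x - u) \<bullet> (proj x - u) - (x - proj x) \<bullet> (proj x - u)"
    by (simp add: inner_diff_left)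
  also have "\<dots> = 0" using assms(2)[OF mem] proj_residual_orthogonal[OF mem] by simp
  finally show ?thesis by simp
qed

lemma proj_id: "x \<in> span B \<Longrightarrow> proj x = x"
  by (rule proj_eqI) auto

lemma proj_eq_0: "(\<And>u. u \<in> span B \<Longrightarrow> x \<bullet> u = 0) \<Longrightarrow> proj x = 0"
  by (rule proj_eqI) (auto simp: span_0)

lemma proj_pythagoras: "(norm x)\<^sup>2 = (norm (proj x))\<^sup>2 + (norm (x - proj x))\<^sup>2"
  using norm_add_Pythagorean[of "proj x" "x - proj x"] proj_residual_orthogonal[OF proj_in_span, of x x]
  by (simp add: orthogonal_def inner_commute)

lemma norm_proj_le: "norm (proj x) \<le> norm x"
  and norm_residual_le: "norm (x - proj x) \<le> norm x"
  by (rule power2_le_imp_le; use proj_pythagoras[of x] in simp)+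

lemma norm_proj_blinfun_le: "norm proj \<le> 1"
  by (rule norm_blinfun_bound) (use norm_proj_le in auto)

lemma dim_span_frame: "dim (span B) = card B"
proof -
  have "0 \<notin> B" using unit_B by fastforce
  then have "independent B" using orthogonal_B by (rule pairwise_orthogonal_independent[rotated])
  then show ?thesis by (simp add: dim_eq_card_independent)
qed

text \<open>The digits form a cubic grid of \<open>m ^ k\<close> points with mesh \<open>h\<close> proportional to \<open>1 / m\<close>, where \<open>k = card B\<close>.
The required ratio is \<open>r = m powr (- k / d)\<close>, and since \<open>d < k\<close> it is far below the mesh when \<open>m\<close> is large.
For \<open>d = 0\<close> a single digit does, and the Cantor set is a point.\<close>

lemma exists_separated_digits:
  assumes "0 \<le> d" "d < real (card B)"
  shows "\<exists>D r. cell_system D r 1 \<and> D \<subseteq> span B \<and> real (card D) * r powr d = 1"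
proof (cases "d = 0")
  case True
  then show ?thesis
    by (intro exI[of _ "{0}"] exI[of _ "1 / 2"]) (auto simp: cell_system_def span_0)
next
  case False
  then have "0 < d" using assms by simp
  let ?k = "card B"
  have k: "0 < ?k" using assms by (intro gr0I) simp
  have "filterlim (\<lambda>m::nat. real m powr (?k / d - 1)) at_top sequentially"
    using \<open>0 < d\<close> assms
    by (intro filterlim_compose[OF real_powr_at_top filterlim_real_sequentially]) (simp add: divide_simps)
  then have "\<forall>\<^sub>F m in sequentially. 12 * real ?k \<le> real m powr (?k / d - 1)"
    by (simp add: filterlim_at_top)
  moreover have "\<forall>\<^sub>F m::nat in sequentially. 2 \<le> m" by (rule eventually_ge_at_top)
  ultimately have "\<forall>\<^sub>F m::nat in sequentially. 12 * real ?k \<le> real m powr (?k / d - 1) \<and> 2 \<le> m"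
    by (rule eventually_conj)
  then obtain m :: nat where m: "12 * real ?k \<le> real m powr (?k / d - 1)" "2 \<le> m"
    using eventually_happens trivial_limit_sequentially by blast
  define h where "h = 1 / (2 * real ?k * real m)"
  define r where "r = real m powr (- (?k / d))"
  have h: "0 < h" using k m by (simp add: h_def)
  have r: "0 < r" using m by (simp add: r_def)
  have "real m powr (?k / d - 1) = 1 / (r * real m)"
    using m by (simp add: r_def powr_diff powr_minus field_simps)
  then have "12 * real ?k \<le> 1 / (r * real m)" using m(1) by simp
  then have "12 * real ?k * (r * real m) \<le> 1"
    using pos_le_divide_eq[of "r * real m" "12 * real ?k" 1] m r by simp
  then have rh: "6 * r \<le> h" using k m by (simp add: h_def field_simps)
  have "h \<le> 1 / 4" using k m mult_mono[of 1 "real ?k" 2 "real m"] by (simp add: h_def field_simps)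
  define pt where "pt c = (\<Sum>b\<in>B. (h * real (c b)) *\<^sub>R b)" for c :: "'a \<Rightarrow> nat"
  define C where "C = B \<rightarrow>\<^sub>E {..<m}"
  have sep: "h \<le> norm (pt c - pt c')" if c: "c \<in> C" "c' \<in> C" "c \<noteq> c'" for c c'
  proof -
    obtain b where b: "b \<in> B" "c b \<noteq> c' b" using c unfolding C_def by (metis PiE_ext)
    have "(pt c - pt c') \<bullet> b = h * (real (c b) - real (c' b))"
      using b by (simp add: pt_def inner_diff_left inner_frame_sum algebra_simps)
    moreover have "1 \<le> \<bar>real (c b) - real (c' b)\<bar>" using b(2) by linarith
    ultimately have "h \<le> \<bar>(pt c - pt c') \<bullet> b\<bar>" using h by (simp add: abs_mult)
    also have "\<dots> \<le> norm (pt c - pt c')"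
      using Cauchy_Schwarz_ineq2[of "pt c - pt c'" b] unit_B[OF b(1)] by simp
    finally show ?thesis .
  qed
  have inj: "inj_on pt C" using sep h by (intro inj_onI) fastforce
  have "card (pt ` C) = m ^ ?k"
    using card_image[OF inj] finite_B by (simp add: C_def card_PiE)
  moreover have "r powr d = 1 / real m ^ ?k"
  proof -
    have "r powr d = real m powr (- real ?k)" using \<open>0 < d\<close> by (simp add: r_def powr_powr)
    also have "\<dots> = 1 / real m ^ ?k" using m by (simp add: powr_minus powr_realpow divide_inverse)
    finally show ?thesis .
  qed
  ultimately have card: "real (card (pt ` C)) * r powr d = 1" using m by simp
  have norm_pt: "norm (pt c) \<le> 1 / 2" if "c \<in> C" for c
  proof -
    have "norm (pt c) \<le> (\<Sum>b\<in>B. h * real m)"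
      unfolding pt_def
    proof (rule sum_norm_le)
      fix b assume "b \<in> B"
      then have "c b < m" using \<open>c \<in> C\<close> by (auto simp: C_def PiE_iff)
      then show "norm ((h * real (c b)) *\<^sub>R b) \<le> h * real m"
        using h unit_B[OF \<open>b \<in> B\<close>] by simp
    qed
    then show ?thesis using k m by (simp add: h_def)
  qed
  have "cell_system (pt ` C) r 1"
  proof
    show "finite (pt ` C)" unfolding C_def using finite_B by (intro finite_imageI finite_PiE) auto
    show "r \<le> 1 / 2" using rh \<open>h \<le> 1 / 4\<close> by simp
    show "norm a + 2 * r \<le> 1" if "a \<in> pt ` C" for a
      using that norm_pt rh \<open>h \<le> 1 / 4\<close> by fastforce
    show "6 * r \<le> norm (a - b)" if "a \<in> pt ` C" "b \<in> pt ` C" "a \<noteq> b" for a b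
      using that sep rh by force
  qed (use r in auto)
  moreover have "pt ` C \<subseteq> span B"
    unfolding pt_def by (intro image_subsetI span_sum span_scale span_base)
  ultimately show ?thesis using card by blast
qed

end

lemma obtain_orthonormal_frame:
  fixes E :: "'a::euclidean_space set"
  assumes "subspace E"
  obtains B where "orthonormal_frame B" "span B = E"
proof -
  obtain B where "B \<subseteq> E" "pairwise orthogonal B" "\<And>x. x \<in> B \<Longrightarrow> norm x = 1" "independent B" "span B = E"
    using orthonormal_basis_subspace[OF assms] by metis
  then show thesis by (intro that[of B]) (auto simp: orthonormal_frame_def independent_imp_finite)
qed

section \<open>A distribution near a point as a field of graphs\<close>

lemma C1_map_on_locally_lipschitz:
  assumes "C1_map_on U f" "open U" "p \<in> U"
  shows "\<exists>e>0. \<exists>K\<ge>0. \<forall>x\<in>cball p e. \<forall>y\<in>cball p e. norm (f x - f y) \<le> K * norm (x - y)"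
proof -
  obtain f' where f': "\<And>x. x \<in> U \<Longrightarrow> (f has_derivative blinfun_apply (f' x)) (at x)" "continuous_on U f'"
    using assms(1) unfolding C1_map_on_def by blast
  obtain d1 where d1: "0 < d1" "cball p d1 \<subseteq> U" using assms open_contains_cball by blast
  have "isCont f' p" using f'(2) assms by (simp add: continuous_on_eq_continuous_at)
  then obtain d2 where d2: "0 < d2" "\<And>x. norm (x - p) < d2 \<Longrightarrow> norm (f' x - f' p) < 1"
    unfolding continuous_at_eps_delta dist_norm by (metis zero_less_one)
  define e where "e = min d1 (d2 / 2)"
  have e: "0 < e" "e \<le> d1" "e < d2" using d1 d2 by (auto simp: e_def min_def)
  have bound: "norm (f' x) \<le> norm (f' p) + 1" if "x \<in> cball p e" for x
  proof -
    have "norm (f' x - f' p) < 1" using that e by (intro d2) (simp add: dist_norm norm_minus_commute)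
    then show ?thesis using norm_triangle_sub[of "f' x" "f' p"] by simp
  qed
  have "norm (f x - f y) \<le> (norm (f' p) + 1) * norm (x - y)" if "x \<in> cball p e" "y \<in> cball p e" for x y
  proof (rule differentiable_bound[OF convex_cball _ _ that])
    fix z assume z: "z \<in> cball p e"
    then have "z \<in> U" using d1(2) e(2) by auto
    then show "(f has_derivative blinfun_apply (f' z)) (at z within cball p e)"
      using f'(1) has_derivative_at_withinI by blast
    show "onorm (blinfun_apply (f' z)) \<le> norm (f' p) + 1"
      using bound[OF z] by (simp add: norm_blinfun.rep_eq)
  qed
  then show ?thesis using e(1) by (intro exI[of _ e] conjI exI[of _ "norm (f' p) + 1"]) auto
qed

lemma uniformly_locally_lipschitz:
  fixes f :: "'i \<Rightarrow> 'a::real_normed_vector \<Rightarrow> 'b::real_normed_vector"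
  assumes "finite I"
    and "\<And>i. i \<in> I \<Longrightarrow> \<exists>e>0. \<exists>K\<ge>0. \<forall>x\<in>cball p e. \<forall>y\<in>cball p e. norm (f i x - f i y) \<le> K * norm (x - y)"
  shows "\<exists>e>0. \<exists>K\<ge>0. \<forall>i\<in>I. \<forall>x\<in>cball p e. \<forall>y\<in>cball p e. norm (f i x - f i y) \<le> K * norm (x - y)"
  using assms
proof (induction I)
  case empty
  show ?case by (intro exI[of _ 1] conjI exI[of _ 0]) auto
next
  case (insert i I)
  obtain e K where e: "0 < e" "0 \<le> K"
    "\<And>j x y. j \<in> I \<Longrightarrow> x \<in> cball p e \<Longrightarrow> y \<in> cball p e \<Longrightarrow> norm (f j x - f j y) \<le> K * norm (x - y)"
    using insert by (metis insertI2)
  obtain e' K' where e': "0 < e'" "0 \<le> K'"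
    "\<And>x y. x \<in> cball p e' \<Longrightarrow> y \<in> cball p e' \<Longrightarrow> norm (f i x - f i y) \<le> K' * norm (x - y)"
    using insert.prems[of i] by blast
  have "norm (f j x - f j y) \<le> (K + K') * norm (x - y)"
    if j: "j \<in> insert i I" and xy: "x \<in> cball p (min e e')" "y \<in> cball p (min e e')" for j x y
  proof -
    have "0 \<le> K * norm (x - y)" "0 \<le> K' * norm (x - y)" using e(2) e'(2) by simp_all
    moreover have "norm (f j x - f j y) \<le> K * norm (x - y) \<or> norm (f j x - f j y) \<le> K' * norm (x - y)"
      using j e(3)[of j x y] e'(3)[of x y] xy by auto
    ultimately show ?thesis unfolding distrib_right by linarith
  qed
  then show ?case using e(1,2) e'(1,2) by (intro exI[of _ "min e e'"] conjI exI[of _ "K + K'"]) auto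
qed

lemma span_image_finite_sum:
  fixes f :: "'i \<Rightarrow> 'a::real_vector"
  assumes "finite I" "v \<in> span (f ` I)"
  shows "\<exists>c. v = (\<Sum>i\<in>I. c i *\<^sub>R f i)"
proof -
  let ?S = "{v. \<exists>c. v = (\<Sum>i\<in>I. c i *\<^sub>R f i)}"
  have "subspace ?S"
    unfolding subspace_def
  proof safe
    show "\<exists>c. 0 = (\<Sum>i\<in>I. c i *\<^sub>R f i)" by (intro exI[of _ "\<lambda>_. 0"]) simp
    show "\<exists>ca. (\<Sum>i\<in>I. c i *\<^sub>R f i) + (\<Sum>i\<in>I. c' i *\<^sub>R f i) = (\<Sum>i\<in>I. ca i *\<^sub>R f i)" for c c'
      by (intro exI[of _ "\<lambda>i. c i + c' i"]) (simp add: scaleR_add_left sum.distrib)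
    show "\<exists>ca. t *\<^sub>R (\<Sum>i\<in>I. c i *\<^sub>R f i) = (\<Sum>i\<in>I. ca i *\<^sub>R f i)" for t c
      by (intro exI[of _ "\<lambda>i. t * c i"]) (simp add: scaleR_sum_right)
  qed
  moreover have "f ` I \<subseteq> ?S"
  proof safe
    fix j assume "j \<in> I"
    then show "\<exists>c. f j = (\<Sum>i\<in>I. c i *\<^sub>R f i)"
      using assms(1) by (intro exI[of _ "\<lambda>i. if i = j then 1 else 0"]) (simp add: if_distrib[of "\<lambda>t. t *\<^sub>R _"] cong: if_cong)
  qed
  ultimately have "span (f ` I) \<subseteq> ?S" by (intro span_minimal)
  then show ?thesis using assms(2) by blast
qed

context orthonormal_frame
begin

text \<open>Writing an orthonormal basis of \<open>V 0\<close> in terms of the spanning fields gives linear maps \<open>A p\<close> with values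
in \<open>V p\<close>, Lipschitz in \<open>p\<close>, and with \<open>A 0\<close> the projection to \<open>V 0\<close>. For small \<open>p\<close> the projection
of \<open>A p\<close> to \<open>V 0\<close> is close to the identity there, hence invertible, and normalising by its
inverse turns \<open>A p\<close> into the graph map \<open>id + M p\<close>.\<close>

lemma distribution_local_graph:
  assumes V: "C1_distribution k V" and E: "span B = V 0"
  shows "\<exists>R>0. \<exists>L\<ge>0. \<exists>M::'a \<Rightarrow> 'a \<Rightarrow>\<^sub>L 'a.
    (\<forall>p\<in>cball 0 R. norm (M p) \<le> 1) \<and>
    (\<forall>p\<in>cball 0 R. \<forall>q\<in>cball 0 R. norm (M p - M q) \<le> L * norm (p - q)) \<and>
    (\<forall>p\<in>cball 0 R. \<forall>v. \<forall>u\<in>span B. blinfun_apply (M p) v \<bullet> u = 0) \<and>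
    (\<forall>p\<in>cball 0 R. V p = (\<lambda>u. u + blinfun_apply (M p) u) ` span B)"
proof -
  have plane: "subspace (V x)" "dim (V x) = k" for x
    using V unfolding C1_distribution_def plane_distribution_def by auto
  obtain U X where U: "open U" "0 \<in> U" and X: "\<And>i. i < k \<Longrightarrow> C1_map_on U (X i)"
    and span_X: "\<And>x. x \<in> U \<Longrightarrow> V x = span ((\<lambda>i. X i x) ` {..<k})"
    using V unfolding C1_distribution_def by metis
  have "\<exists>c. \<forall>b\<in>B. b = (\<Sum>i<k. c b i *\<^sub>R X i 0)"
  proof (rule bchoice[of B "\<lambda>b c. b = (\<Sum>i<k. c i *\<^sub>R X i 0)"], rule ballI)
    fix b assume "b \<in> B"
    then have "b \<in> span ((\<lambda>i. X i 0) ` {..<k})"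
      using E span_X[OF U(2)] span_base[of b B] by simp
    then show "\<exists>c. b = (\<Sum>i<k. c i *\<^sub>R X i 0)" by (intro span_image_finite_sum) auto
  qed
  then obtain c where c: "\<And>b. b \<in> B \<Longrightarrow> b = (\<Sum>i<k. c b i *\<^sub>R X i 0)" by blast
  obtain e1 K1 where e1: "0 < e1" and K1: "0 \<le> K1"
    and lipX: "\<And>i x y. i < k \<Longrightarrow> x \<in> cball 0 e1 \<Longrightarrow> y \<in> cball 0 e1 \<Longrightarrow> norm (X i x - X i y) \<le> K1 * norm (x - y)"
    using uniformly_locally_lipschitz[of "{..<k}" 0 X] C1_map_on_locally_lipschitz[OF X U] by auto
  obtain e2 where e2: "0 < e2" "cball 0 e2 \<subseteq> U" using U open_contains_cball by blast
  define A where "A p = (\<Sum>b\<in>B. rank_one b (\<Sum>i<k. c b i *\<^sub>R X i p))" for p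
  have A_apply: "A p x = (\<Sum>b\<in>B. (x \<bullet> b) *\<^sub>R (\<Sum>i<k. c b i *\<^sub>R X i p))" for p x
    by (simp add: A_def blinfun.sum_left inner_commute)
  have A_0: "A 0 = proj"
    unfolding A_def proj_def using c by (intro sum.cong) auto
  have A_in_V: "A p x \<in> V p" if "p \<in> U" for p x
    unfolding A_apply span_X[OF that] by (intro span_sum span_scale span_base) auto
  define K where "K = (\<Sum>b\<in>B. \<Sum>i<k. \<bar>c b i\<bar>) * K1"
  have K: "0 \<le> K" unfolding K_def using K1 by (intro mult_nonneg_nonneg sum_nonneg) auto
  have A_lip: "norm (A p x - A q x) \<le> K * norm (p - q) * norm x"
    if pq: "p \<in> cball 0 e1" "q \<in> cball 0 e1" for p q x
  proof -
    have "A p x - A q x = (\<Sum>b\<in>B. (x \<bullet> b) *\<^sub>R (\<Sum>i<k. c b i *\<^sub>R (X i p - X i q)))"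
      by (simp add: A_apply sum_subtractf scaleR_diff_right)
    also have "norm \<dots> \<le> (\<Sum>b\<in>B. norm x * (\<Sum>i<k. \<bar>c b i\<bar> * (K1 * norm (p - q))))"
    proof (rule sum_norm_le)
      fix b assume b: "b \<in> B"
      have "norm (\<Sum>i<k. c b i *\<^sub>R (X i p - X i q)) \<le> (\<Sum>i<k. \<bar>c b i\<bar> * (K1 * norm (p - q)))"
        using lipX pq by (intro sum_norm_le) (auto intro!: mult_left_mono)
      moreover have "\<bar>x \<bullet> b\<bar> \<le> norm x" using Cauchy_Schwarz_ineq2[of x b] unit_B[OF b] by simp
      ultimately show "norm ((x \<bullet> b) *\<^sub>R (\<Sum>i<k. c b i *\<^sub>R (X i p - X i q)))
          \<le> norm x * (\<Sum>i<k. \<bar>c b i\<bar> * (K1 * norm (p - q)))"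
        unfolding norm_scaleR by (intro mult_mono) auto
    qed
    also have "\<dots> = K * norm (p - q) * norm x"
      by (simp add: K_def sum_distrib_left sum_distrib_right mult_ac)
    finally show ?thesis .
  qed
  define R where "R = min (min e1 e2) (1 / (4 * (K + 1)))"
  have R: "0 < R" "R \<le> e1" "R \<le> e2" using e1 e2 K by (auto simp: R_def)
  have KR: "K * R \<le> 1 / 4"
  proof -
    have "K * R \<le> (K + 1) * (1 / (4 * (K + 1)))"
      using K R by (intro mult_mono) (auto simp: R_def)
    also have "(K + 1) * (1 / (4 * (K + 1))) = 1 / 4" using K by (simp add: field_simps)
    finally show ?thesis .
  qed
  have in_e1: "p \<in> cball 0 e1" if "p \<in> cball 0 R" for p using that R by auto
  have in_U: "p \<in> U" if "p \<in> cball 0 R" for p using that R e2 by auto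
  have A_near: "norm (A p x - proj x) \<le> norm x / 4" if "p \<in> cball 0 R" for p x
  proof -
    have "norm (A p x - proj x) \<le> K * norm p * norm x"
      using A_lip[of p 0 x] in_e1[OF that] e1 by (simp add: A_0)
    also have "\<dots> \<le> K * R * norm x"
      using K that by (intro mult_right_mono mult_left_mono) auto
    also have "\<dots> \<le> 1 / 4 * norm x" using KR by (intro mult_right_mono) auto
    finally show ?thesis by simp
  qed
  \<comment> \<open>\<open>T p\<close> is the projection of \<open>A p\<close> on the plane and the identity on its complement, which makes it a map
    of the whole space close to the identity.\<close>
  define T where "T p x = proj (A p x) + (x - proj x)" for p x
  have T_linear: "linear (T p)" for p
    unfolding T_def by (intro linearI) (simp_all add: blinfun.bilinear_simps algebra_simps)
  have proj_proj: "proj (proj x) = proj x" for x by (rule proj_id[OF proj_in_span])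
  have T_near: "norm (T p x - x) \<le> norm x / 4" if "p \<in> cball 0 R" for p x
  proof -
    have "T p x - x = proj (A p x - proj x)" by (simp add: T_def blinfun.bilinear_simps proj_proj)
    then show ?thesis using norm_proj_le[of "A p x - proj x"] A_near[OF that, of x] by simp
  qed
  have T_lower: "norm x \<le> 4 / 3 * norm (T p x)" if "p \<in> cball 0 R" for p x
    using T_near[OF that, of x] norm_triangle_sub[of x "T p x"] by (simp add: norm_minus_commute)
  have T_inj: "inj (T p)" if "p \<in> cball 0 R" for p
    unfolding linear_injective_0[OF T_linear]
  proof (intro allI impI)
    show "x = 0" if "T p x = 0" for x using T_lower[OF \<open>p \<in> cball 0 R\<close>, of x] that by simp
  qed
  have T_surj: "surj (T p)" if "p \<in> cball 0 R" for p
    using T_linear T_inj[OF that] by (rule linear_inj_imp_surj)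
  define G where "G p = inv (T p)" for p
  have TG: "T p (G p y) = y" if "p \<in> cball 0 R" for p y
    unfolding G_def using T_surj[OF that] by (rule surj_f_inv_f)
  have GT: "G p (T p x) = x" if "p \<in> cball 0 R" for p x
    unfolding G_def using T_inj[OF that] by (rule inv_f_f)
  have G_linear: "linear (G p)" if p: "p \<in> cball 0 R" for p
  proof (rule linearI)
    show "G p (x + y) = G p x + G p y" for x y
      using GT[OF p, of "G p x + G p y"] by (simp add: linear_add[OF T_linear] TG[OF p])
    show "G p (t *\<^sub>R x) = t *\<^sub>R G p x" for t x
      using GT[OF p, of "t *\<^sub>R G p x"] by (simp add: linear_scale[OF T_linear] TG[OF p])
  qed
  have G_norm: "norm (G p y) \<le> 4 / 3 * norm y" if "p \<in> cball 0 R" for p y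
    using T_lower[OF that, of "G p y"] TG[OF that] by simp
  have proj_T: "proj (T p x) = proj (A p x)" for p x
    by (simp add: T_def blinfun.bilinear_simps proj_proj)
  define m where "m p v = A p (G p (proj v)) - proj v" for p v
  have proj_AG: "proj (A p (G p (proj v))) = proj v" if "p \<in> cball 0 R" for p v
    using proj_T[of p "G p (proj v)"] TG[OF that] by (simp add: proj_proj)
  have m_residual: "m p v = A p (G p (proj v)) - proj (A p (G p (proj v)))" if "p \<in> cball 0 R" for p v
    using proj_AG[OF that] by (simp add: m_def)
  have m_linear: "linear (m p)" if "p \<in> cball 0 R" for p
    unfolding m_def
    by (intro linearI)
      (simp_all add: blinfun.bilinear_simps linear_add[OF G_linear[OF that]]
        linear_scale[OF G_linear[OF that]] algebra_simps)
  define M where "M p = Blinfun (m p)" for p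
  have M_apply: "M p v = m p v" if "p \<in> cball 0 R" for p v
    unfolding M_def using m_linear[OF that] by (simp add: bounded_linear_Blinfun_apply linear_conv_bounded_linear)
  have M_norm: "norm (M p) \<le> 1" if p: "p \<in> cball 0 R" for p
  proof (rule norm_blinfun_bound)
    fix v
    let ?u = "G p (proj v)" let ?w = "A p ?u - proj ?u"
    have "M p v = ?w - proj ?w"
      unfolding M_apply[OF p] m_residual[OF p] by (simp add: blinfun.bilinear_simps proj_proj)
    then have "norm (M p v) \<le> norm ?u / 4"
      using norm_residual_le[of ?w] A_near[OF p, of ?u] by simp
    then show "norm (M p v) \<le> 1 * norm v"
      using G_norm[OF p, of "proj v"] norm_proj_le[of v] norm_ge_zero[of v] by linarith
  qed simp
  have M_lip: "norm (M p - M q) \<le> 4 * K * norm (p - q)" if p: "p \<in> cball 0 R" and q: "q \<in> cball 0 R" for p q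
  proof (rule norm_blinfun_bound)
    fix v
    define u where "u = G p (proj v)"
    define w where "w = G q (proj v)"
    have u: "norm u \<le> 4 / 3 * norm v"
      using G_norm[OF p, of "proj v"] norm_proj_le[of v] by (simp add: u_def)
    have Aw: "norm (A p u - A q u) \<le> K * norm (p - q) * norm u"
      using A_lip in_e1 p q by blast
    have "T q (u - w) = T q u - T p u"
      using TG[OF p, of "proj v"] TG[OF q, of "proj v"] by (simp add: linear_diff[OF T_linear] u_def w_def)
    also have "\<dots> = proj (A q u - A p u)" by (simp add: T_def blinfun.bilinear_simps)
    finally have "norm (T q (u - w)) \<le> K * norm (p - q) * norm u"
      using norm_proj_le[of "A q u - A p u"] Aw by (simp add: norm_minus_commute)
    then have uw: "norm (u - w) \<le> 4 / 3 * (K * norm (p - q) * norm u)"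
      using T_lower[OF q, of "u - w"] by simp
    have "norm (A q (u - w)) \<le> 5 / 4 * norm (u - w)"
      using A_near[OF q, of "u - w"] norm_proj_le[of "u - w"]
        norm_triangle_sub[of "A q (u - w)" "proj (u - w)"] by simp
    moreover have "(M p - M q) v = (A p u - A q u + A q (u - w)) - proj (A p u - A q u + A q (u - w))"
      by (simp add: blinfun.bilinear_simps M_apply[OF p] M_apply[OF q] m_residual[OF p] m_residual[OF q]
          u_def w_def)
    then have "norm ((M p - M q) v) \<le> norm (A p u - A q u) + norm (A q (u - w))"
      using norm_residual_le norm_triangle_ineq by (metis order_trans)
    moreover have "0 \<le> K * norm (p - q) * norm u" using K by simp
    ultimately have "norm ((M p - M q) v) \<le> 3 * (K * norm (p - q) * norm u)"
      using Aw uw by linarith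
    also have "\<dots> \<le> 3 * (K * norm (p - q) * (4 / 3 * norm v))"
      using u K by (intro mult_left_mono) auto
    also have "\<dots> = 4 * K * norm (p - q) * norm v" by simp
    finally show "norm ((M p - M q) v) \<le> 4 * K * norm (p - q) * norm v" .
  qed (use K in simp)
  have M_orth: "M p v \<bullet> u = 0" if "p \<in> cball 0 R" "u \<in> span B" for p v u
    unfolding M_apply[OF that(1)] m_residual[OF that(1)] by (rule proj_residual_orthogonal[OF that(2)])
  have V_graph: "V p = (\<lambda>u. u + M p u) ` span B" if p: "p \<in> cball 0 R" for p
  proof -
    let ?g = "\<lambda>u. u + M p u"
    have lin: "linear ?g" by (intro linearI) (simp_all add: blinfun.bilinear_simps algebra_simps)
    have sub: "?g ` span B \<subseteq> V p"
    proof safe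
      fix u assume "u \<in> span B"
      then have "?g u = A p (G p u)" by (simp add: M_apply[OF p] m_def proj_id)
      then show "?g u \<in> V p" using A_in_V[OF in_U[OF p]] by simp
    qed
    have "inj_on ?g (span B)"
    proof (rule inj_onI)
      fix u w assume uw: "u \<in> span B" "w \<in> span B" "?g u = ?g w"
      have "proj (?g u) = u" if "u \<in> span B" for u
        using that proj_eq_0[OF M_orth[OF p]] by (simp add: blinfun.bilinear_simps proj_id)
      then show "u = w" using uw by metis
    qed
    then have "dim (?g ` span B) = dim (span B)"
      using lin by (intro dim_image_eq) (auto simp: span_span)
    also have "\<dots> = dim (V p)" using plane E by simp
    finally show ?thesis
      using sub lin plane by (intro subspace_dim_equal[symmetric] linear_subspace_image) auto
  qed
  show ?thesis
    using R(1) K M_norm M_lip M_orth V_graph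
    by (intro exI[of _ R] conjI exI[of _ "4 * K"] exI[of _ M]) auto
qed

end

section \<open>Graphs as submanifolds\<close>

context orthonormal_frame
begin

text \<open>The charts of a graph are the shear \<open>z - f (proj z)\<close> and its inverse \<open>z + f (proj z)\<close>; the
factor \<open>c\<close> treats both at once.\<close>

lemma C11_shear:
  fixes f :: "'a \<Rightarrow> 'a"
  assumes f: "\<And>x. (f has_derivative blinfun_apply (f' x)) (at x)"
    and lip: "\<And>x y. norm (f' x - f' y) \<le> L * norm (x - y)" and "0 \<le> L" and c: "\<bar>c\<bar> \<le> 1"
  shows "C11_map_on U (\<lambda>z. z + c *\<^sub>R f (proj z))"
  unfolding C11_map_on_def
proof (intro exI[of _ "\<lambda>z. id_blinfun + c *\<^sub>R (f' (proj z) o\<^sub>L proj)"] conjI ballI)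
  fix z
  have "((\<lambda>z. f (proj z)) has_derivative (\<lambda>h. f' (proj z) (proj h))) (at z)"
    by (rule has_derivative_compose[OF _ f]) (rule bounded_linear_imp_has_derivative[OF blinfun.bounded_linear_right])
  then show "((\<lambda>z. z + c *\<^sub>R f (proj z)) has_derivative
      blinfun_apply (id_blinfun + c *\<^sub>R (f' (proj z) o\<^sub>L proj))) (at z)"
    by (auto intro!: derivative_eq_intros simp: blinfun.bilinear_simps fun_eq_iff)
next
  fix z
  have "norm ((id_blinfun + c *\<^sub>R (f' (proj x) o\<^sub>L proj)) - (id_blinfun + c *\<^sub>R (f' (proj y) o\<^sub>L proj)))
      \<le> L * norm (x - y)" for x y
  proof -
    have "(id_blinfun + c *\<^sub>R (f' (proj x) o\<^sub>L proj)) - (id_blinfun + c *\<^sub>R (f' (proj y) o\<^sub>L proj))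
        = c *\<^sub>R ((f' (proj x) - f' (proj y)) o\<^sub>L proj)"
      by (rule blinfun_eqI) (simp add: blinfun.bilinear_simps algebra_simps)
    also have "norm \<dots> \<le> 1 * (norm (f' (proj x) - f' (proj y)) * 1)"
      unfolding norm_scaleR using c
      by (intro mult_mono order_trans[OF norm_blinfun_compose] mult_left_mono norm_proj_blinfun_le) auto
    also have "\<dots> \<le> L * norm (proj (x - y))" using lip[of "proj x" "proj y"] by (simp add: blinfun.bilinear_simps)
    also have "\<dots> \<le> L * norm (x - y)" using \<open>0 \<le> L\<close> norm_proj_le by (rule mult_left_mono[rotated])
    finally show ?thesis .
  qed
  then have "L-lipschitz_on (ball z 1 \<inter> U) (\<lambda>z. id_blinfun + c *\<^sub>R (f' (proj z) o\<^sub>L proj))"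
    using \<open>0 \<le> L\<close> by (intro lipschitz_onI) (simp_all add: dist_norm)
  then show "\<exists>e>0. \<exists>L. L-lipschitz_on (ball z e \<inter> U) (\<lambda>z. id_blinfun + c *\<^sub>R (f' (proj z) o\<^sub>L proj))"
    using zero_less_one by blast
qed

lemma graph_C11_submanifold:
  fixes f :: "'a \<Rightarrow> 'a"
  assumes f: "\<And>x. (f has_derivative blinfun_apply (f' x)) (at x)"
    and lip: "\<And>x y. norm (f' x - f' y) \<le> L * norm (x - y)" and "0 \<le> L"
    and orth: "\<And>x u. u \<in> span B \<Longrightarrow> f x \<bullet> u = 0" and "0 < \<epsilon>"
  shows "C11_submanifold (card B) ((\<lambda>x. x + f x) ` (span B \<inter> ball 0 \<epsilon>))"
proof -
  let ?S = "(\<lambda>x. x + f x) ` (span B \<inter> ball 0 \<epsilon>)"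
  define U where "U = {z. norm (proj z) < \<epsilon>}"
  define \<phi> where "\<phi> z = z + (- 1) *\<^sub>R f (proj z)" for z
  define \<psi> where "\<psi> z = z + 1 *\<^sub>R f (proj z)" for z
  have proj_f: "proj (f x) = 0" for x using orth by (intro proj_eq_0)
  have proj_\<phi>: "proj (\<phi> z) = proj z" and proj_\<psi>: "proj (\<psi> z) = proj z" for z
    by (simp_all add: \<phi>_def \<psi>_def blinfun.bilinear_simps proj_f)
  have inv: "\<psi> (\<phi> z) = z" "\<phi> (\<psi> z) = z" for z
  proof -
    have "\<psi> (\<phi> z) = \<phi> z + f (proj z)" unfolding \<psi>_def[of "\<phi> z"] proj_\<phi> by simp
    also have "\<dots> = z" by (simp add: \<phi>_def)
    finally show "\<psi> (\<phi> z) = z" .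
    have "\<phi> (\<psi> z) = \<psi> z - f (proj z)" unfolding \<phi>_def[of "\<psi> z"] proj_\<psi> by simp
    also have "\<dots> = z" by (simp add: \<psi>_def)
    finally show "\<phi> (\<psi> z) = z" .
  qed
  have "open U" unfolding U_def by (intro open_Collect_less continuous_intros)
  have f_cont: "continuous_on UNIV f"
    using f by (intro continuous_at_imp_continuous_on) (auto intro: has_derivative_continuous)
  have cont: "continuous_on U \<phi>" "continuous_on U \<psi>"
    unfolding \<phi>_def \<psi>_def by (intro continuous_intros continuous_on_compose2[OF f_cont]; simp)+
  have "homeomorphism U U \<phi> \<psi>"
  proof (rule homeomorphismI[OF cont])
    show "\<phi> ` U \<subseteq> U" "\<psi> ` U \<subseteq> U" by (auto simp: U_def proj_\<phi> proj_\<psi>)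
  qed (use inv in auto)
  moreover have "C11_map_on U \<phi>" "C11_map_on U \<psi>"
    unfolding \<phi>_def \<psi>_def by (intro C11_shear[OF f lip \<open>0 \<le> L\<close>]; simp)+
  moreover have "?S \<subseteq> U" by (auto simp: U_def blinfun.bilinear_simps proj_f proj_id)
  moreover have "\<phi> ` (?S \<inter> U) = span B \<inter> U"
  proof -
    have graph: "\<phi> (x + f x) = x" if "x \<in> span B" for x
      using that by (simp add: \<phi>_def blinfun.bilinear_simps proj_f proj_id)
    have "\<phi> ` ?S = span B \<inter> ball 0 \<epsilon>"
      unfolding image_image using graph by (simp cong: image_cong_simp)
    also have "\<dots> = span B \<inter> U" by (auto simp: U_def proj_id)
    finally show ?thesis using \<open>?S \<subseteq> U\<close> by (simp add: Int_absorb2)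
  qed
  moreover have "?S \<noteq> {}" using \<open>0 < \<epsilon>\<close> span_0[of B] by auto
  ultimately show ?thesis
    unfolding C11_submanifold_def using \<open>open U\<close> dim_span_frame
    by (intro conjI ballI exI[of _ U] exI[of _ \<phi>] exI[of _ \<psi>] exI[of _ "span B"]) auto
qed

text \<open>A curve in the graph is the lift of its own projection, so its velocity is \<open>v + f' x v\<close> with \<open>v\<close>
the velocity of the projection; conversely the lifts of straight lines realise all these velocities.\<close>

lemma tangent_space_graph:
  fixes f :: "'a \<Rightarrow> 'a"
  assumes f: "\<And>x. (f has_derivative blinfun_apply (f' x)) (at x)"
    and cont: "continuous_on UNIV f'"
    and orth: "\<And>x u. u \<in> span B \<Longrightarrow> f x \<bullet> u = 0"
    and x: "x \<in> span B" "norm x < \<epsilon>"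
  shows "tangent_space ((\<lambda>x. x + f x) ` (span B \<inter> ball 0 \<epsilon>)) (x + f x)
    = (\<lambda>v. v + f' x v) ` span B"
proof (intro subset_antisym subsetI)
  let ?S = "(\<lambda>x. x + f x) ` (span B \<inter> ball 0 \<epsilon>)"
  have proj_graph: "proj (y + f y) = y" if "y \<in> span B" for y
    using that orth by (simp add: blinfun.bilinear_simps proj_id proj_eq_0)
  {
    fix v assume "v \<in> tangent_space ?S (x + f x)"
    then obtain e \<gamma> where e: "0 < e" and \<gamma>: "\<gamma> ` {-e<..<e} \<subseteq> ?S" "\<gamma> 0 = x + f x"
      "(\<gamma> has_vector_derivative v) (at 0)"
      unfolding tangent_space_def by blast
    have eq: "\<gamma> t = proj (\<gamma> t) + f (proj (\<gamma> t))" if "t \<in> {-e<..<e}" for t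
      using \<gamma>(1) that proj_graph by force
    have "((\<lambda>t. proj (\<gamma> t)) has_derivative (\<lambda>t. proj (t *\<^sub>R v))) (at 0)"
      using \<gamma>(3) unfolding has_vector_derivative_def
      by (rule bounded_linear.has_derivative[OF blinfun.bounded_linear_right])
    moreover have "proj (\<gamma> 0) = x" using \<gamma>(2) proj_graph[OF x(1)] by simp
    ultimately have "((\<lambda>t. proj (\<gamma> t) + f (proj (\<gamma> t))) has_derivative (\<lambda>t. proj (t *\<^sub>R v) + f' x (proj (t *\<^sub>R v)))) (at 0)"
      using has_derivative_compose[of "\<lambda>t. proj (\<gamma> t)" "\<lambda>t. proj (t *\<^sub>R v)" 0 UNIV f "f' x"] f[of x]
      by (intro has_derivative_add) auto
    then have "((\<lambda>t. proj (\<gamma> t) + f (proj (\<gamma> t))) has_vector_derivative (proj v + f' x (proj v))) (at 0)"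
      by (simp add: has_vector_derivative_def blinfun.bilinear_simps scaleR_add_right)
    then have "(\<gamma> has_vector_derivative (proj v + f' x (proj v))) (at 0)"
      by (rule has_vector_derivative_transform_within_open[of _ _ _ "{-e<..<e}"]) (use e eq in auto)
    then have "v = proj v + f' x (proj v)"
      using vector_derivative_unique_at \<gamma>(3) by blast
    then show "v \<in> (\<lambda>v. v + f' x v) ` span B" using proj_in_span by blast
  next
    fix w assume "w \<in> (\<lambda>v. v + f' x v) ` span B"
    then obtain v where v: "v \<in> span B" "w = v + f' x v" by blast
    define e where "e = (\<epsilon> - norm x) / (norm v + 1)"
    have e: "0 < e" using x by (simp add: e_def add_nonneg_pos)
    define \<gamma> where "\<gamma> t = (x + t *\<^sub>R v) + f (x + t *\<^sub>R v)" for t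
    have deriv: "(\<gamma> has_vector_derivative (v + f' (x + t *\<^sub>R v) v)) (at t)" for t
    proof -
      have line: "((\<lambda>t. x + t *\<^sub>R v) has_derivative (\<lambda>s. s *\<^sub>R v)) (at t)"
        by (auto intro!: derivative_eq_intros)
      show ?thesis
        unfolding \<gamma>_def[abs_def] has_vector_derivative_def
        by (rule has_derivative_eq_rhs[OF has_derivative_add[OF line has_derivative_compose[OF line f]]])
          (simp add: fun_eq_iff blinfun.bilinear_simps scaleR_add_right)
    qed
    have "continuous_on UNIV (\<lambda>t. v + f' (x + t *\<^sub>R v) v)"
      by (intro continuous_intros continuous_on_compose2[OF cont]) auto
    then have "\<gamma> C1_differentiable_on {-e<..<e}"
      unfolding C1_differentiable_on_def using deriv by (meson continuous_on_subset subset_UNIV)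
    moreover have "\<gamma> ` {-e<..<e} \<subseteq> ?S"
    proof safe
      fix t assume t: "t \<in> {-e<..<e}"
      have "\<bar>t\<bar> * norm v \<le> e * norm v" using t by (intro mult_right_mono) auto
      also have "\<dots> < e * (norm v + 1)" using e by simp
      also have "norm v + 1 \<noteq> 0" using norm_ge_zero[of v] by linarith
      then have "e * (norm v + 1) = \<epsilon> - norm x" by (simp add: e_def)
      finally have "norm (x + t *\<^sub>R v) < \<epsilon>" using norm_triangle_ineq[of x "t *\<^sub>R v"] by simp
      moreover have "x + t *\<^sub>R v \<in> span B" using x(1) v(1) by (intro span_add span_scale)
      ultimately show "\<gamma> t \<in> ?S" unfolding \<gamma>_def by auto
    qed
    moreover have "\<gamma> 0 = x + f x" "(\<gamma> has_vector_derivative w) (at 0)"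
      using deriv[of 0] v(2) by (simp_all add: \<gamma>_def)
    ultimately show "w \<in> tangent_space ?S (x + f x)"
      unfolding tangent_space_def using e by blast
  }
qed

end

section \<open>Tangency sets of prescribed dimension\<close>

lemma (in cell_system) norm_cantor_less: "x \<in> cantor \<Longrightarrow> norm x < \<epsilon>"
proof -
  assume "x \<in> cantor"
  then obtain u where u: "u \<in> words (Suc 0)" "norm (x - centre u) \<le> radius (Suc 0)"
    unfolding cantor_def by blast
  then obtain a where a: "u = [a]" "a \<in> D" by (auto elim!: words_Suc_cases)
  have "norm x \<le> \<epsilon> * r + \<epsilon> * norm a"
    using u(2) norm_triangle_sub[of x "\<epsilon> *\<^sub>R a"] \<epsilon>_pos by (simp add: a radius_def)
  also have "\<dots> = \<epsilon> * (norm a + r)" by (simp add: algebra_simps)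
  also have "\<dots> < \<epsilon> * 1" using D_norm[OF a(2)] r_pos \<epsilon>_pos by (intro mult_strict_left_mono) auto
  finally show ?thesis by simp
qed

lemma cell_system_rescale: "cell_system D r 1 \<Longrightarrow> 0 < \<epsilon> \<Longrightarrow> cell_system D r \<epsilon>"
  by (simp add: cell_system_def)

theorem theorem1p1p2:
  fixes k :: nat and V :: "real ^ 'n \<Rightarrow> (real ^ 'n) set" and d :: real
  assumes "2 \<le> k" and "k < CARD('n)"
    and "C1_distribution k V"
    and "0 \<le> d" and "d < real k"
  shows "\<exists>S. C11_submanifold k S \<and> hausdorff_dim (tangency_set S V) = ereal d"
proof -
  have V0: "subspace (V 0)" "dim (V 0) = k"
    using assms(3) unfolding C1_distribution_def plane_distribution_def by auto
  obtain B where "orthonormal_frame B" and E: "span B = V 0"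
    using obtain_orthonormal_frame[OF V0(1)] .
  then interpret orthonormal_frame B by simp
  have card_B: "card B = k" using dim_span_frame E V0 by simp
  obtain D r where D: "cell_system D r 1" "D \<subseteq> span B" "real (card D) * r powr d = 1"
    using exists_separated_digits assms card_B by blast
  obtain R L and M :: "real ^ 'n \<Rightarrow> (real ^ 'n) \<Rightarrow>\<^sub>L (real ^ 'n)" where R: "0 < R" and L: "0 \<le> L"
    and M: "\<forall>p\<in>cball 0 R. norm (M p) \<le> 1"
      "\<forall>p\<in>cball 0 R. \<forall>q\<in>cball 0 R. norm (M p - M q) \<le> L * norm (p - q)"
      "\<forall>p\<in>cball 0 R. \<forall>v. \<forall>u\<in>span B. M p v \<bullet> u = 0"
      "\<forall>p\<in>cball 0 R. V p = (\<lambda>u. u + M p u) ` span B"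
    using distribution_local_graph[OF assms(3) E] by (elim exE conjE) (rule that)
  note M_norm = M(1)[rule_format] and M_lip = M(2)[rule_format]
    and M_orth = M(3)[rule_format] and M_graph = M(4)[rule_format]
  \<comment> \<open>Retracting to the ball makes the slope field global, with the same bounds. The graph
    will stay inside the ball, where nothing has changed.\<close>
  define N where "N x y = M (closest_point (cball 0 R) (x + y))" for x y
  have cp: "closest_point (cball 0 R) p \<in> cball 0 R" for p :: "real ^ 'n"
    using R by (intro closest_point_in_set) auto
  have N_lip: "norm (N x y - N x' y') \<le> L * (norm (x - x') + norm (y - y'))" for x y x' y'
  proof -
    have "norm (N x y - N x' y') \<le> L * dist (closest_point (cball 0 R) (x + y)) (closest_point (cball 0 R) (x' + y'))"
      unfolding N_def dist_norm by (intro M_lip cp)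
    also have "\<dots> \<le> L * dist (x + y) (x' + y')"
      using R L by (intro mult_left_mono closest_point_lipschitz) auto
    also have "dist (x + y) (x' + y') \<le> norm (x - x') + norm (y - y')"
      unfolding dist_norm by (rule norm_diff_triangle_ineq)
    finally show ?thesis using L by (simp add: mult_left_mono)
  qed
  obtain e where e: "e \<in> B" using card_B assms(1) by (metis card.empty ex_in_conv not_numeral_le_zero)
  have "dim (span B) < DIM(real ^ 'n)" using E V0 assms(2) by simp
  then obtain \<nu>0 where \<nu>0: "\<nu>0 \<noteq> 0" "\<And>u. u \<in> span B \<Longrightarrow> orthogonal \<nu>0 u"
    using orthogonal_to_subspace_exists[of "span B"] by (auto simp: span_span)
  define \<nu> where "\<nu> = \<nu>0 /\<^sub>R norm \<nu>0"
  have \<nu>: "norm \<nu> = 1" "\<And>u. u \<in> span B \<Longrightarrow> \<nu> \<bullet> u = 0"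
    using \<nu>0 by (auto simp: \<nu>_def orthogonal_def)
  have r: "0 < r" using D(1) by (simp add: cell_system_def)
  define b where "b = (38 * L + 1) / r"
  have b: "0 < b" "38 * L < b * r" using r L by (simp_all add: b_def)
  \<comment> \<open>A point of the graph over the ball of radius \<open>\<epsilon>\<close> has norm at most \<open>11 * \<epsilon>\<close>.\<close>
  define \<epsilon> where "\<epsilon> = min (1 / b) (R / 12)"
  have \<epsilon>: "0 < \<epsilon>" "b * \<epsilon> \<le> 1" "12 * \<epsilon> \<le> R"
    using b R by (auto simp: \<epsilon>_def min_def field_simps)
  interpret tangency_graph D r \<epsilon> N L b e \<nu>
  proof (intro tangency_graph.intro tangency_graph_axioms.intro)
    show "cell_system D r \<epsilon>" using D(1) \<epsilon>(1) by (rule cell_system_rescale)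
    show "norm (N x y) \<le> 1" for x y unfolding N_def by (intro M_norm cp)
  qed (use N_lip L b \<epsilon> \<nu> unit_B[OF e] in auto)
  let ?f = bump_sum and ?g = "\<lambda>x. x + bump_sum x"
  have f_orth: "?f x \<bullet> u = 0" if "u \<in> span B" for x u
    using \<nu>(2)[OF that] by (rule bump_sum_orthogonal) (simp add: N_def M_orth[OF cp that])
  have f'_cont: "continuous_on UNIV bump_sum'"
    using bump_sum'_lipschitz H_nonneg
    by (intro lipschitz_on_continuous_on[of "236 * jump_bound"] lipschitz_onI) (auto simp: dist_norm)
  define S where "S = ?g ` (span B \<inter> ball 0 \<epsilon>)"
  have "C11_submanifold k S"
    unfolding S_def card_B[symmetric] using H_nonneg
    by (intro graph_C11_submanifold[OF bump_sum_has_derivative bump_sum'_lipschitz] f_orth \<epsilon>(1)) auto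
  moreover have "hausdorff_dim (tangency_set S V) = ereal d"
  proof -
    have tangent: "tangent_space S (?g x) = V (?g x) \<longleftrightarrow> x \<in> cantor"
      if x: "x \<in> span B" "norm x < \<epsilon>" for x
    proof -
      have "norm (?g x) \<le> R"
        using norm_triangle_ineq[of x "?f x"] norm_bump_sum_le[of x] x(2) \<epsilon> by simp
      then have gR: "?g x \<in> cball 0 R" by simp
      then have N_eq: "N x (?f x) = M (?g x)" by (simp add: N_def closest_point_self)
      have tan: "tangent_space S (?g x) = (\<lambda>v. v + bump_sum' x v) ` span B"
        unfolding S_def
        by (rule tangent_space_graph[OF bump_sum_has_derivative f'_cont f_orth x])
      show ?thesis
      proof
        assume "x \<in> cantor"
        then show "tangent_space S (?g x) = V (?g x)"
          unfolding tan M_graph[OF gR] using bump_sum'_on_cantor N_eq by simp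
      next
        assume eq: "tangent_space S (?g x) = V (?g x)"
        show "x \<in> cantor"
        proof (rule ccontr)
          assume "x \<notin> cantor"
          have eB: "e \<in> span B" using e by (rule span_base)
          then have "e + bump_sum' x e \<in> V (?g x)" using eq unfolding tan by blast
          then obtain u where u: "u \<in> span B" "e + bump_sum' x e = u + M (?g x) u"
            unfolding M_graph[OF gR] by blast
          \<comment> \<open>Comparing the components of \<open>e + bump_sum' x e = u + M (x + bump_sum x) u\<close> along the plane
            gives \<open>e = u\<close>.\<close>
          have f'_orth: "bump_sum' x e \<bullet> w = 0" if "w \<in> span B" for w
          proof -
            have "((\<lambda>y. ?f y \<bullet> w) has_derivative (\<lambda>h. bump_sum' x h \<bullet> w)) (at x)"
              by (rule has_derivative_inner_left[OF bump_sum_has_derivative])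
            then have "((\<lambda>y. 0) has_derivative (\<lambda>h. bump_sum' x h \<bullet> w)) (at x)"
              using f_orth[OF that] by simp
            then have "(\<lambda>h. bump_sum' x h \<bullet> w) = (\<lambda>h. 0)"
              using has_derivative_unique has_derivative_const by blast
            then show ?thesis by metis
          qed
          have "e - u = M (?g x) u - bump_sum' x e" using u(2) by (simp add: algebra_simps)
          moreover have "(M (?g x) u - bump_sum' x e) \<bullet> (e - u) = 0"
            using span_diff[OF eB u(1)] M_orth[OF gR] f'_orth by (simp add: inner_diff_left)
          ultimately have "e = u" by (metis inner_eq_zero_iff right_minus_eq)
          then have "bump_sum' x e = N x (?f x) e" using u(2) N_eq by simp
          then show False using bump_sum'_off_cantor[of x] \<open>x \<notin> cantor\<close> x(2) by simp
        qed
      qed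
    qed
    then have "tangency_set S V = ?g ` (span B \<inter> ball 0 \<epsilon> \<inter> cantor)"
      unfolding tangency_set_def S_def by fastforce
    also have "span B \<inter> ball 0 \<epsilon> \<inter> cantor = cantor \<inter> span B"
      using norm_cantor_less by auto
    also have "hausdorff_dim (?g ` (cantor \<inter> span B)) = ereal d"
    proof (rule hausdorff_dim_image_cantor[where C = 11 and p = "\<lambda>w. centre w + height w"])
      show "norm (x - y) \<le> dist (?g x) (?g y)" if "x \<in> cantor \<inter> span B" "y \<in> cantor \<inter> span B" for x y
      proof -
        have "proj (?g x - ?g y) = x - y"
          using that f_orth by (simp add: blinfun.bilinear_simps proj_id proj_eq_0)
        then show ?thesis using norm_proj_le[of "?g x - ?g y"] by (simp add: dist_norm)
      qed
      show "dist (centre w + height w) (?g x) \<le> 11 * radius j"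
        if "w \<in> words j" "norm (x - centre w) \<le> radius j" for j w x
      proof -
        have "dist (centre w + height w) (?g x) = norm ((x - centre w) + (?f x - height w))"
          by (simp add: dist_norm norm_minus_commute algebra_simps)
        also have "\<dots> \<le> norm (x - centre w) + norm (?f x - height w)" by (rule norm_triangle_ineq)
        finally show ?thesis using bump_sum_near_height[OF that] that(2) by simp
      qed
    qed (use D assms in auto)
    finally show ?thesis .
  qed
  ultimately show ?thesis by blast
qed

end
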